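(* Let $A\in M_n(\mathbb{C})$ and let $k\ge 1$ be an integer. Then $$c_{n,k}\,N_k(A)^k=\sum_{l=1}^k\ \sum_{\beta\in S^k_l}\frac{1}{z_\beta}\prod_{t=1}^l \lVert A\rVert_{(\beta_t)}^{\beta_t}.$$
   Context: $\mathbb{S}^n$ denotes the unit sphere of $\mathbb{C}^n$, $\sigma$ the normalized Euclidean surface measure on it, $\lVert\cdot\rVert_2$ the Euclidean norm, and $|A|=\sqrt{A^\star A}$. For real $q\ge1$, $N_q(A)=\Big(\int_{\mathbb{S}^n}\lVert |A|^{1/2}\xi\rVert_2^{2q}\,d\sigma(\xi)\Big)^{1/q}$. $c_{n,k}=\binom{n+k-1}{k}$. For real $p\ge 1$, $\lVert A\rVert_{(p)}=[\mathrm{tr}(|A|^p)]^{1/p}$ is the Schatten $p$-norm. $S^k_l$ is the set of partitions of $k$ with exactly $l$ nonzero parts, i.e. tuples $\beta=(\beta_1,\dots,\beta_k)$ of nonnegative integers with $\beta_1\ge\beta_2\ge\cdots\ge\beta_k$, $\beta_1+\cdots+\beta_k=k$, $\beta_l\neq 0$ and $\beta_i=0$ for all $i>l$. For such $\beta$, $z_\beta=\prod_{i\ge1} i^{m_i}\,m_i!$, where $m_i$ is the number of parts of $\beta$ equal to $i$. *)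

theory Defs
  imports "HOL-Analysis.Analysis"
begin

definition conj_transpose :: "complex^'n^'m \<Rightarrow> complex^'m^'n" where
  "conj_transpose A = (\<chi> i j. cnj (A $ j $ i))"

definition unitary_mat :: "complex^'n^'n \<Rightarrow> bool" where
  "unitary_mat U \<longleftrightarrow> conj_transpose U ** U = mat 1 \<and> U ** conj_transpose U = mat 1"

definition real_diag :: "('n \<Rightarrow> real) \<Rightarrow> complex^'n^'n" where
  "real_diag d = (\<chi> i j. if i = j then complex_of_real (d i) else 0)"

text \<open>Functional calculus: if \<open>P = U diag(d) U\<^sup>*\<close> with \<open>U\<close> unitary and \<open>d\<close> real, then
  \<open>f(P) = U diag(f(d)) U\<^sup>*\<close>, which does not depend on the diagonalization chosen.
  Only meaningful when \<open>P\<close> is Hermitian.\<close>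

definition herm_fun :: "(real \<Rightarrow> real) \<Rightarrow> complex^'n^'n \<Rightarrow> complex^'n^'n" where
  "herm_fun f P = (THE Q. \<exists>U d. unitary_mat U \<and>
      P = U ** real_diag d ** conj_transpose U \<and>
      Q = U ** real_diag (\<lambda>i. f (d i)) ** conj_transpose U)"

definition mat_abs :: "complex^'n^'n \<Rightarrow> complex^'n^'n" where
  "mat_abs A = herm_fun sqrt (conj_transpose A ** A)"

text \<open>Only used for positive semidefinite \<open>P\<close> and \<open>p > 0\<close>, so that the convention
  \<open>0 powr p = 0\<close> is the right one on the kernel of \<open>P\<close>.\<close>

definition psd_powr :: "complex^'n^'n \<Rightarrow> real \<Rightarrow> complex^'n^'n" where
  "psd_powr P p = herm_fun (\<lambda>x. x powr p) P"

text \<open>The trace of \<open>|A|\<^sup>p\<close> is a nonnegative real; \<open>Re\<close> only changes its type.\<close>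

definition schatten_norm :: "real \<Rightarrow> complex^'n^'n \<Rightarrow> real" where
  "schatten_norm p A = Re (trace (psd_powr (mat_abs A) p)) powr (1 / p)"

text \<open>The normalized surface measure of the unit sphere as the cone measure: the mass of a Borel
  set \<open>E\<close> of unit vectors is the volume of \<open>{r x | x \<in> E, 0 < r < 1}\<close> divided by the volume of
  the unit ball. Volume is the Lebesgue measure of \<open>complex^'n\<close> as a real Euclidean space of
  dimension \<open>2 * CARD('n)\<close>.\<close>

definition sphere_measure :: "(complex^'n) measure" where
  "sphere_measure =
     restrict_space (distr (uniform_measure lborel (ball 0 1)) borel (\<lambda>x. x /\<^sub>R norm x)) (sphere 0 1)"

definition N_norm :: "real \<Rightarrow> complex^'n^'n \<Rightarrow> real" where
  "N_norm q A =
     (\<integral>\<xi>. norm (psd_powr (mat_abs A) (1/2) *v \<xi>) powr (2 * q) \<partial>sphere_measure) powr (1 / q)"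

text \<open>A \<open>k\<close>-tuple \<open>(\<beta>\<^sub>1, \<dots>, \<beta>\<^sub>k)\<close> is a function that vanishes outside \<open>{1..k}\<close>.\<close>

definition partitions_with_parts :: "nat \<Rightarrow> nat \<Rightarrow> (nat \<Rightarrow> nat) set" where
  "partitions_with_parts k l =
     {\<beta>. (\<forall>i. i \<notin> {1..k} \<longrightarrow> \<beta> i = 0) \<and>
         (\<forall>i\<in>{1..k}. \<forall>j\<in>{1..k}. i \<le> j \<longrightarrow> \<beta> j \<le> \<beta> i) \<and>
         (\<Sum>i=1..k. \<beta> i) = k \<and>
         \<beta> l \<noteq> 0 \<and> (\<forall>i>l. \<beta> i = 0)}"

definition part_mult :: "nat \<Rightarrow> (nat \<Rightarrow> nat) \<Rightarrow> nat \<Rightarrow> nat" where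
  "part_mult k \<beta> i = card {j \<in> {1..k}. \<beta> j = i}"

text \<open>No part of a partition of \<open>k\<close> exceeds \<open>k\<close>, so the factors with \<open>i > k\<close> are 1.\<close>

definition z_part :: "nat \<Rightarrow> (nat \<Rightarrow> nat) \<Rightarrow> nat" where
  "z_part k \<beta> = (\<Prod>i=1..k. i ^ part_mult k \<beta> i * fact (part_mult k \<beta> i))"

end

theory Submission
  imports Defs "HOL-Probability.Distributions"
begin

text \<open>By the singular value decomposition and the unitary invariance of the sphere, both sides depend
  only on the singular values \<open>s\<^sub>i\<close>. The Gaussian integral of \<open>exp (t \<Sum>\<^sub>i s\<^sub>i |x\<^sub>i|\<^sup>2)\<close> is
  proportional to \<open>\<Prod>\<^sub>i 1 / (1 - t s\<^sub>i)\<close>, the generating function of the complete homogeneous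
  symmetric polynomials \<open>h\<^sub>k(s)\<close>. Since \<open>\<Sum>\<^sub>i s\<^sub>i |x\<^sub>i|\<^sup>2\<close> is homogeneous, its Gaussian moments
  are radial constants times its spherical moments; the case \<open>s = (1, \<dots>, 1)\<close> identifies these
  constants, so the left-hand side is \<open>h\<^sub>k(s)\<close>. The right-hand side is the expansion of
  \<open>h\<^sub>k\<close> in power sums, which follows from
  \<open>\<Prod>\<^sub>i 1 / (1 - t s\<^sub>i) = exp (\<Sum>\<^sub>m p\<^sub>m(s) t\<^sup>m / m)\<close>.\<close>

section \<open>The spectral theorem for Hermitian matrices\<close>

text \<open>Diagonalizing \<open>conj_transpose A ** A\<close> by a unitary U is enough: if s_i are
  the square roots of its eigenvalues and y is the adjoint of U applied to x, the integrand of N_k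
  at x is H(y)^k with H(y) = sum of s_i |y_i|^2. As \<open>herm_fun\<close> is a \<open>THE\<close>,
  its independence of the diagonalization has to be proved first. The sphere carries the cone
  measure, so moments are integrals over the ball of f = (H / |x|^2)^k, which is homogeneous of
  degree 0. Polar integration is replaced by comparing two image measures under the norm on
  half-lines. The Gaussian is the weight that is radial and also factors over the coordinates.
  Restricting to t >= 0 keeps every term nonnegative: sum and integral may be exchanged freely and
  the moments come out finite, at the price that the power series are compared only to the right of
  0.\<close>

definition hinner :: "complex^'n \<Rightarrow> complex^'n \<Rightarrow> complex" where
  "hinner x y = (\<Sum>i\<in>UNIV. cnj (x $ i) * y $ i)"

lemma Re_hinner: "Re (hinner x y) = x \<bullet> y"
  by (simp add: hinner_def inner_vec_def inner_complex_def)

lemma hinner_commute: "hinner y x = cnj (hinner x y)"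
  by (simp add: hinner_def mult.commute)

lemma hinner_add_right: "hinner x (y + z) = hinner x y + hinner x z"
  by (simp add: hinner_def algebra_simps sum.distrib)

lemma hinner_scale_left: "hinner (c *s x) y = cnj c * hinner x y"
  by (simp add: hinner_def sum_distrib_left mult.assoc)

lemma hinner_scaleR_right: "hinner x (r *\<^sub>R y) = of_real r * hinner x y"
  by (simp add: hinner_def sum_distrib_left) (simp add: scaleR_conv_of_real mult_ac)

lemma hinner_0_right [simp]: "hinner x 0 = 0"
  by (simp add: hinner_def)

lemma hinner_self: "hinner x x = complex_of_real ((norm x)\<^sup>2)"
  unfolding hinner_def norm_vec_def L2_set_def
  by (simp add: sum_nonneg mult.commute flip: complex_norm_square)

lemma hinner_eq_0_iff: "hinner x y = 0 \<longleftrightarrow> x \<bullet> y = 0 \<and> (\<i> *s x) \<bullet> y = 0"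
  by (simp add: complex_eq_iff hinner_scale_left flip: Re_hinner)

lemma hinner_conj_transpose: "hinner (A *v x) y = hinner x (conj_transpose A *v y)"
proof -
  have "hinner (A *v x) y = (\<Sum>i\<in>UNIV. \<Sum>j\<in>UNIV. cnj (A $ i $ j) * cnj (x $ j) * y $ i)"
    by (simp add: hinner_def matrix_vector_mult_def sum_distrib_right)
  also have "\<dots> = (\<Sum>j\<in>UNIV. \<Sum>i\<in>UNIV. cnj (A $ i $ j) * cnj (x $ j) * y $ i)"
    by (rule sum.swap)
  also have "\<dots> = hinner x (conj_transpose A *v y)"
    by (simp add: hinner_def matrix_vector_mult_def conj_transpose_def sum_distrib_left mult_ac)
  finally show ?thesis .
qed

lemma conj_transpose_conj_transpose [simp]: "conj_transpose (conj_transpose A) = A"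
  by (simp add: conj_transpose_def vec_eq_iff)

lemma conj_transpose_mult: "conj_transpose (A ** B) = conj_transpose B ** conj_transpose A"
  by (simp add: conj_transpose_def vec_eq_iff matrix_matrix_mult_def mult.commute)

text \<open>Complex orthogonality to \<open>v i\<close> is real orthogonality to both
  \<open>v i\<close> and \<open>\<i> *s v i\<close>. That is at most 2 card S real conditions in
  real dimension 2 CARD('n).\<close>

lemma exists_unit_hinner_orthogonal:
  fixes v :: "'n::finite \<Rightarrow> complex^'n"
  assumes "card S < CARD('n)"
  obtains y where "norm y = 1" "\<And>i. i \<in> S \<Longrightarrow> hinner (v i) y = 0"
proof -
  let ?T = "v ` S \<union> (\<lambda>i. \<i> *s v i) ` S"
  have "dim (span ?T) \<le> card ?T"
    by (simp add: dim_le_card')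
  also have "\<dots> \<le> card (v ` S) + card ((\<lambda>i. \<i> *s v i) ` S)"
    by (rule card_Un_le)
  also have "\<dots> \<le> card S + card S"
    by (intro add_mono card_image_le) auto
  also have "\<dots> < DIM(complex^'n)"
    using assms by simp
  finally have "dim (span ?T) < DIM(complex^'n)" .
  then obtain x where x: "x \<noteq> 0" "\<And>y. y \<in> span ?T \<Longrightarrow> orthogonal x y"
    using orthogonal_to_subspace_exists[of ?T] by auto
  have "hinner (v i) x = 0" if "i \<in> S" for i
    using x(2)[of "v i"] x(2)[of "\<i> *s v i"] that
    by (auto simp: hinner_eq_0_iff orthogonal_def inner_commute span_base)
  with x(1) show thesis
    by (intro that[of "x /\<^sub>R norm x"]) (auto simp: hinner_scaleR_right)
qed

lemma hinner_hermitian_eigenvector_eq_0: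
  assumes "conj_transpose P = P" "P *v x = complex_of_real c *s x" "hinner x y = 0"
  shows "hinner x (P *v y) = 0"
  by (metis assms hinner_conj_transpose hinner_scale_left mult_zero_right)

lemma matrix_vector_mult_scaleR_right:
  fixes P :: "complex^'n^'m"
  shows "P *v (t *\<^sub>R y) = t *\<^sub>R (P *v y)"
  by (simp add: matrix_vector_mult_def vec_eq_iff scaleR_sum_right)

lemma linear_matrix_vector_mult: "linear ((*v) (P :: complex^'n^'m))"
  by (intro linearI) (simp_all add: matrix_vector_right_distrib matrix_vector_mult_scaleR_right)

text \<open>A maximiser of the Rayleigh quotient on an invariant closed subspace is an eigenvector.\<close>
lemma hermitian_eigenvector_orthogonal:
  fixes P :: "complex^'n^'n" and v :: "'n \<Rightarrow> complex^'n"
  assumes P: "conj_transpose P = P" and S: "card S < CARD('n)"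
    and v: "\<And>i. i \<in> S \<Longrightarrow> P *v v i = complex_of_real (d i) *s v i"
  obtains x c where "norm x = 1" "\<And>i. i \<in> S \<Longrightarrow> hinner (v i) x = 0"
    "P *v x = complex_of_real c *s x"
proof -
  define W where "W = {y. \<forall>i\<in>S. hinner (v i) y = 0}"
  have W: "subspace W"
    unfolding W_def by (rule subspaceI) (simp_all add: hinner_add_right hinner_scaleR_right)
  have WP: "P *v y \<in> W" if "y \<in> W" for y
    using that v P unfolding W_def
    by (auto intro: hinner_hermitian_eigenvector_eq_0)
  let ?K = "W \<inter> sphere 0 1"
  have "compact ?K"
    by (rule closed_Int_compact[OF closed_subspace[OF W] compact_sphere])
  moreover have "?K \<noteq> {}"
  proof -
    obtain y where "norm y = 1" "\<And>i. i \<in> S \<Longrightarrow> hinner (v i) y = 0"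
      using exists_unit_hinner_orthogonal[OF S, of v] by metis
    then have "y \<in> ?K"
      by (simp add: W_def)
    then show ?thesis
      by blast
  qed
  moreover have "continuous_on ?K (\<lambda>y. (P *v y) \<bullet> y)"
    using linear_matrix_vector_mult[of P]
    by (intro continuous_on_inner linear_continuous_on continuous_on_id)
      (simp add: linear_conv_bounded_linear)
  ultimately have "\<exists>x\<in>?K. \<forall>y\<in>?K. (P *v y) \<bullet> y \<le> (P *v x) \<bullet> x"
    by (rule continuous_attains_sup)
  then obtain x where x: "x \<in> W" "norm x = 1"
    and max: "\<And>y. y \<in> ?K \<Longrightarrow> (P *v y) \<bullet> y \<le> (P *v x) \<bullet> x"
    by (metis IntE mem_sphere_0)
  define c where "c = (P *v x) \<bullet> x"
  \<comment> \<open>The homogeneous form of maximality: \<open>q\<close> is nonpositive on all of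
    \<open>W\<close> and vanishes at \<open>x\<close>, so perturbations of \<open>x\<close> need no
    normalization.\<close>
  define q where "q y = (P *v y) \<bullet> y - c * (y \<bullet> y)" for y
  have q_le: "q y \<le> 0" if "y \<in> W" for y
  proof (cases "y = 0")
    case False
    have "(P *v (y /\<^sub>R norm y)) \<bullet> (y /\<^sub>R norm y) \<le> c"
      unfolding c_def using False that W by (intro max) (auto simp: subspace_scale)
    then have "((P *v y) \<bullet> y) / (norm y)\<^sup>2 \<le> c"
      by (simp add: matrix_vector_mult_scaleR_right power2_eq_square divide_simps)
    with False show ?thesis
      by (simp add: q_def divide_simps flip: power2_norm_eq_inner)
  qed (simp add: q_def)
  define w where "w = P *v x - c *\<^sub>R x"
  have wW: "w \<in> W"
    unfolding w_def using x W WP by (simp add: subspace_diff subspace_scale)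
  have sym: "(P *v y) \<bullet> z = (P *v z) \<bullet> y" for y z
    by (metis P Re_hinner hinner_conj_transpose inner_commute)
  \<comment> \<open>Perturbing along the residual \<open>w\<close> makes the first-order term
    \<open>2 * t * (w \<bullet> w)\<close>, which must not be positive.\<close>
  have expand: "q (x + t *\<^sub>R w) = 2 * t * (w \<bullet> w) + t\<^sup>2 * q w" for t
  proof -
    have "q (x + t *\<^sub>R w) = q x + 2 * t * ((P *v x) \<bullet> w - c * (x \<bullet> w)) + t\<^sup>2 * q w"
      using sym[of w x] unfolding q_def
      by (simp add: matrix_vector_right_distrib
          matrix_vector_mult_scaleR_right inner_add_left inner_add_right inner_commute
          power2_eq_square algebra_simps)
    moreover have "q x = 0"
      by (simp add: q_def c_def x flip: power2_norm_eq_inner)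
    moreover have "(P *v x) \<bullet> w - c * (x \<bullet> w) = w \<bullet> w"
      by (simp add: w_def inner_diff_left)
    ultimately show ?thesis by simp
  qed
  have "w = 0"
  proof (rule ccontr)
    assume "w \<noteq> 0"
    then have ww: "w \<bullet> w > 0" by simp
    \<comment> \<open>Small enough that the second-order term is at most half of the first-order
      one; the \<open>+ 1\<close> keeps the denominator positive.\<close>
    define t where "t = (w \<bullet> w) / (\<bar>q w\<bar> + 1)"
    have t: "t > 0" using ww by (simp add: t_def)
    have "q (x + t *\<^sub>R w) \<le> 0"
      by (intro q_le) (simp add: W x wW subspace_add subspace_scale)
    then have "t * (2 * (w \<bullet> w) + t * q w) \<le> 0"
      unfolding expand by (simp add: algebra_simps power2_eq_square)
    then have "2 * (w \<bullet> w) + t * q w \<le> 0"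
      using t by (simp add: mult_le_0_iff)
    moreover have "t * \<bar>q w\<bar> \<le> w \<bullet> w"
      using ww by (simp add: t_def divide_simps mult_left_mono)
    moreover have "- (t * \<bar>q w\<bar>) \<le> t * q w"
      using t by (simp add: abs_if)
    ultimately show False using ww by linarith
  qed
  then have "P *v x = complex_of_real c *s x"
    by (simp add: w_def vec_eq_iff) (simp add: scaleR_conv_of_real)
  with x show thesis
    by (intro that[of x c]) (auto simp: W_def)
qed

text \<open>The eigenvectors are indexed by the type \<open>'n\<close> itself and the induction runs
  over the indices already served; the index about to be added shows that there is still room for an
  orthogonal eigenvector.\<close>

lemma hermitian_orthonormal_eigenvectors:
  fixes P :: "complex^'n^'n"
  assumes "conj_transpose P = P"
  shows "\<exists>(v :: 'n \<Rightarrow> complex^'n) d. \<forall>i\<in>S. P *v v i = complex_of_real (d i) *s v i \<and>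
           (\<forall>j\<in>S. hinner (v i) (v j) = (if i = j then 1 else 0))"
proof -
  have "finite S" by simp
  then show ?thesis
  proof (induction S rule: finite_induct)
    case (insert a S)
    then obtain v d where v: "\<And>i. i \<in> S \<Longrightarrow> P *v v i = complex_of_real (d i) *s v i"
      and on: "\<And>i j. i \<in> S \<Longrightarrow> j \<in> S \<Longrightarrow> hinner (v i) (v j) = (if i = j then 1 else 0)"
      by metis
    have "card S < CARD('n)"
      using insert.hyps by (metis UNIV_I finite_class.finite_UNIV psubset_card_mono psubsetI subset_UNIV)
    then obtain x c where x: "norm x = 1" "\<And>i. i \<in> S \<Longrightarrow> hinner (v i) x = 0"
      "P *v x = complex_of_real c *s x"
      using hermitian_eigenvector_orthogonal[of P S v d] assms v by metis
    have x': "hinner x (v i) = 0" if "i \<in> S" for i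
      using x(2)[OF that] hinner_commute[of "v i" x] by simp
    have "hinner x x = 1"
      by (simp add: hinner_self x)
    then show ?case
      using insert.hyps x x' v on
      by (intro exI[of _ "v(a := x)"] exI[of _ "d(a := c)"]) auto
  qed auto
qed

theorem hermitian_diagonalization:
  fixes P :: "complex^'n^'n"
  assumes "conj_transpose P = P"
  obtains U d where "unitary_mat U" "P = U ** real_diag d ** conj_transpose U"
proof -
  obtain v :: "'n \<Rightarrow> complex^'n" and d
    where v: "\<And>i. P *v v i = complex_of_real (d i) *s v i"
      and on: "\<And>i j. hinner (v i) (v j) = (if i = j then 1 else 0)"
    using hermitian_orthonormal_eigenvectors[OF assms, of UNIV] by auto
  define U :: "complex^'n^'n" where "U = (\<chi> i j. v j $ i)"
  have "conj_transpose U ** U = mat 1"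
    using on by (simp add: U_def conj_transpose_def matrix_matrix_mult_def hinner_def mat_def vec_eq_iff)
  then have U: "unitary_mat U"
    by (simp add: unitary_mat_def matrix_left_right_inverse)
  have "P ** U = U ** real_diag d"
  proof -
    have "(P ** U) $ i $ j = (P *v v j) $ i" for i j
      by (simp add: U_def matrix_matrix_mult_def matrix_vector_mult_def)
    moreover have "(U ** real_diag d) $ i $ j = complex_of_real (d j) * v j $ i" for i j
      by (simp add: U_def matrix_matrix_mult_def real_diag_def if_distrib mult.commute cong: if_cong)
    ultimately show ?thesis by (simp add: vec_eq_iff v)
  qed
  then have "P = U ** real_diag d ** conj_transpose U"
    using U by (metis matrix_mul_assoc matrix_mul_rid unitary_mat_def)
  with U show thesis by (rule that)
qed

section \<open>Independence of the functional calculus from the diagonalization\<close>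

text \<open>Entrywise, either \<open>W $ i $ j = 0\<close> or \<open>d j = e i\<close>; in both
  cases applying \<open>f\<close> preserves the equation.\<close>

lemma real_diag_intertwine:
  assumes "W ** real_diag d = real_diag e ** (W :: complex^'n^'n)"
  shows "W ** real_diag (\<lambda>i. f (d i)) = real_diag (\<lambda>i. f (e i)) ** W"
proof -
  have L: "(W ** real_diag d) $ i $ j = W $ i $ j * complex_of_real (d j)" for i j d
    by (simp add: matrix_matrix_mult_def real_diag_def if_distrib cong: if_cong)
  have R: "(real_diag d ** W) $ i $ j = complex_of_real (d i) * W $ i $ j" for i j d
    by (simp add: matrix_matrix_mult_def real_diag_def if_distribR if_distrib cong: if_cong)
  have "W $ i $ j * complex_of_real (d j) = complex_of_real (e i) * W $ i $ j" for i j
    using assms by (metis L R)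
  then have "W $ i $ j * complex_of_real (f (d j)) = complex_of_real (f (e i)) * W $ i $ j" for i j
    by (cases "W $ i $ j = 0") (fastforce simp: mult.commute)+
  then show ?thesis by (simp add: vec_eq_iff L R)
qed

text \<open>Two diagonalizations, by U and V, are linked by W = (adjoint of V) U, which intertwines
  the diagonal matrices and hence also their images under \<open>f\<close>.\<close>

lemma herm_fun_diagonalization:
  fixes U :: "complex^'n^'n"
  assumes U: "unitary_mat U"
  shows "herm_fun f (U ** real_diag d ** conj_transpose U) =
    U ** real_diag (\<lambda>i. f (d i)) ** conj_transpose U"
  unfolding herm_fun_def
proof (rule the_equality)
  fix Q
  assume "\<exists>V e. unitary_mat V \<and> U ** real_diag d ** conj_transpose U = V ** real_diag e ** conj_transpose V \<and>
     Q = V ** real_diag (\<lambda>i. f (e i)) ** conj_transpose V"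
  then obtain V e where V: "unitary_mat V"
    and eq: "U ** real_diag d ** conj_transpose U = V ** real_diag e ** conj_transpose V"
    and Q: "Q = V ** real_diag (\<lambda>i. f (e i)) ** conj_transpose V" by blast
  define W where "W = conj_transpose V ** U"
  have VW: "V ** W = U" and WU: "W ** conj_transpose U = conj_transpose V"
    using U V by (simp_all add: W_def unitary_mat_def matrix_mul_assoc)
      (simp add: flip: matrix_mul_assoc)
  have "W ** real_diag d = conj_transpose V ** (U ** real_diag d ** conj_transpose U) ** U"
    using U by (simp add: W_def unitary_mat_def flip: matrix_mul_assoc)
  also have "\<dots> = real_diag e ** W"
    unfolding eq using V by (simp add: W_def unitary_mat_def matrix_mul_assoc)
  finally have *: "W ** real_diag (\<lambda>i. f (d i)) = real_diag (\<lambda>i. f (e i)) ** W"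
    by (rule real_diag_intertwine)
  have "Q = V ** (real_diag (\<lambda>i. f (e i)) ** W) ** conj_transpose U"
    by (simp add: Q WU flip: matrix_mul_assoc)
  also have "\<dots> = U ** real_diag (\<lambda>i. f (d i)) ** conj_transpose U"
    by (simp add: VW matrix_mul_assoc flip: *)
  finally show "Q = U ** real_diag (\<lambda>i. f (d i)) ** conj_transpose U" .
qed (use U in blast)

section \<open>Lebesgue measure under isometries and in polar form\<close>

text \<open>Uniqueness of Haar measure: Fubini's theorem and translation invariance give
  \<open>M X * L B = L X * M (- B)\<close>, and the ball is symmetric.\<close>
lemma translation_invariant_eq_lborel:
  fixes M :: "'a::euclidean_space measure"
  assumes M: "sets M = sets borel" "sigma_finite_measure M"
    and inv: "\<And>a. distr M borel (\<lambda>x. x + a) = M"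
    and ball: "emeasure M (ball 0 1) = emeasure lborel (ball (0::'a) 1)"
  shows "M = lborel"
proof (rule measure_eqI)
  fix X assume "X \<in> sets M"
  then have X [measurable]: "X \<in> sets borel" by (simp add: M)
  note M(1) [measurable_cong]
  let ?B = "ball (0::'a) 1"
  have [measurable]: "?B \<in> sets borel" by simp
  interpret M: sigma_finite_measure M by fact
  interpret pair_sigma_finite M lborel
    by (simp add: pair_sigma_finite_def M sigma_finite_lborel)
  have M_shift: "emeasure M {x. x + y \<in> X} = emeasure M X" for y
    using arg_cong[OF inv[of y], of "\<lambda>N. emeasure N X"] M
    by (subst (asm) emeasure_distr) (auto simp: vimage_def sets_eq_imp_space_eq[OF M(1)] cong: measurable_cong_sets)
  have M_ball: "emeasure M {x. y - x \<in> ?B} = emeasure lborel ?B" for y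
  proof -
    have "{x. x + - y \<in> ?B} = {x. y - x \<in> ?B}"
      by (auto simp: dist_norm norm_minus_commute)
    moreover have "emeasure M {x. x + - y \<in> ?B} = emeasure M ?B"
      using arg_cong[OF inv[of "- y"], of "\<lambda>N. emeasure N ?B"] M
      by (subst (asm) emeasure_distr) (auto simp: vimage_def sets_eq_imp_space_eq[OF M(1)] cong: measurable_cong_sets)
    ultimately show ?thesis by (simp add: ball)
  qed
  have L_shift: "(\<integral>\<^sup>+y. indicator X (x + y) * indicator ?B y \<partial>lborel) =
      (\<integral>\<^sup>+y. indicator X y * indicator ?B (y - x) \<partial>lborel)" for x :: 'a
  proof -
    have [measurable]: "(\<lambda>y. indicator ?B (y - x) :: ennreal) \<in> borel_measurable borel"
      by measurable
    show ?thesis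
      by (subst (2) lborel_distr_plus[of x, symmetric], subst nn_integral_distr) auto
  qed
  have "emeasure M X * emeasure lborel ?B = (\<integral>\<^sup>+y. (\<integral>\<^sup>+x. indicator X (x + y) * indicator ?B y \<partial>M) \<partial>lborel)"
  proof -
    have "(\<integral>\<^sup>+x. indicator X (x + y) \<partial>M) = emeasure M X" for y
    proof -
      have "(\<integral>\<^sup>+x. indicator X (x + y) \<partial>M) = (\<integral>\<^sup>+x. indicator {x. x + y \<in> X} x \<partial>M)"
        by (simp add: indicator_def)
      also have "\<dots> = emeasure M {x. x + y \<in> X}"
        by (rule nn_integral_indicator) (simp add: M pred_def[symmetric])
      finally show ?thesis by (simp add: M_shift)
    qed
    then show ?thesis
      by (simp add: nn_integral_multc nn_integral_cmult)
  qed
  also have "\<dots> = (\<integral>\<^sup>+x. (\<integral>\<^sup>+y. indicator X (x + y) * indicator ?B y \<partial>lborel) \<partial>M)"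
    by (rule Fubini') measurable
  also have "\<dots> = (\<integral>\<^sup>+x. (\<integral>\<^sup>+y. indicator X y * indicator ?B (y - x) \<partial>lborel) \<partial>M)"
    by (simp add: L_shift)
  also have "\<dots> = (\<integral>\<^sup>+y. (\<integral>\<^sup>+x. indicator X y * indicator ?B (y - x) \<partial>M) \<partial>lborel)"
    by (rule Fubini'[symmetric]) measurable
  also have "\<dots> = emeasure lborel X * emeasure lborel ?B"
  proof -
    have "(\<integral>\<^sup>+x. indicator ?B (y - x) \<partial>M) = emeasure lborel ?B" for y
    proof -
      have "(\<integral>\<^sup>+x. indicator ?B (y - x) \<partial>M) = (\<integral>\<^sup>+x. indicator {x. y - x \<in> ?B} x \<partial>M)"
        by (simp add: indicator_def)
      also have "\<dots> = emeasure M {x. y - x \<in> ?B}"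
        by (rule nn_integral_indicator) (simp add: M pred_def[symmetric] del: mem_ball)
      finally show ?thesis by (simp only: M_ball)
    qed
    then show ?thesis
      by (simp add: nn_integral_multc nn_integral_cmult)
  qed
  finally have "emeasure M X * emeasure lborel ?B = emeasure lborel X * emeasure lborel ?B" .
  moreover have "emeasure lborel ?B \<noteq> 0"
    using content_ball_pos[of 1 "0::'a"] by (auto simp: measure_def)
  ultimately show "emeasure M X = emeasure lborel X"
    using emeasure_lborel_ball_finite[of "0::'a" 1]
    by (auto simp: mult.commute[of _ "emeasure lborel ?B"] ennreal_mult_cancel_left)
qed (simp add: M)

text \<open>Balls centred at 0 are preserved, which gives the normalization and sigma-finiteness.
  Translating by \<open>a\<close> after \<open>f\<close> is translating by a preimage of
  \<open>a\<close> before \<open>f\<close>, so the image measure is translation invariant.\<close>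

lemma distr_lborel_orthogonal_transformation:
  fixes f :: "'a::euclidean_space \<Rightarrow> 'a"
  assumes f: "orthogonal_transformation f"
  shows "distr lborel borel f = lborel"
proof (rule translation_invariant_eq_lborel)
  have lin: "linear f" and nrm: "\<And>x. norm (f x) = norm x"
    using f by (auto simp: orthogonal_transformation)
  have f_meas [measurable]: "f \<in> borel_measurable borel"
    using lin by (intro borel_measurable_continuous_onI linear_continuous_on)
      (simp add: linear_conv_bounded_linear)
  have vim: "f -` ball 0 r = ball 0 r" for r
    by (auto simp: nrm)
  then show ball: "emeasure (distr lborel borel f) (ball 0 1) = emeasure lborel (ball (0::'a) 1)"
    by (simp add: emeasure_distr)
  show "sigma_finite_measure (distr lborel borel f)"
  proof
    show "\<exists>A. countable A \<and> A \<subseteq> sets (distr lborel borel f) \<and> \<Union>A = space (distr lborel borel f) \<and>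
        (\<forall>a\<in>A. emeasure (distr lborel borel f) a \<noteq> \<infinity>)"
    proof (intro exI[of _ "range (\<lambda>n::nat. ball (0::'a) (real n))"] conjI)
      show "\<Union> (range (\<lambda>n::nat. ball (0::'a) (real n))) = space (distr lborel borel f)"
        using reals_Archimedean2 by auto
      show "\<forall>a\<in>range (\<lambda>n::nat. ball (0::'a) (real n)). emeasure (distr lborel borel f) a \<noteq> \<infinity>"
        using emeasure_lborel_ball_finite by (auto simp: emeasure_distr vim less_top)
    qed auto
  qed
  show "distr (distr lborel borel f) borel (\<lambda>x. x + a) = distr lborel borel f" for a
  proof -
    obtain b where b: "f b = a"
      using orthogonal_transformation_surj[OF f] by (metis surjD)
    have "distr (distr lborel borel f) borel (\<lambda>x. x + a) = distr lborel borel (\<lambda>x. f (b + x))"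
      by (simp add: distr_distr o_def linear_add[OF lin] b add.commute)
    also have "\<dots> = distr (distr lborel borel ((+) b)) borel f"
      by (simp add: distr_distr o_def)
    finally show ?thesis by (simp add: lborel_distr_plus)
  qed
qed simp

lemma nn_integral_homogeneous_ball:
  fixes f :: "'a::euclidean_space \<Rightarrow> ennreal"
  assumes [measurable]: "f \<in> borel_measurable borel"
    and hom: "\<And>c x. c > 0 \<Longrightarrow> f (c *\<^sub>R x) = f x" and r: "r > 0"
  shows "(\<integral>\<^sup>+x. f x * indicator (ball 0 r) x \<partial>lborel) =
    ennreal (r ^ DIM('a)) * (\<integral>\<^sup>+x. f x * indicator (ball 0 1) x \<partial>lborel)"
proof -
  have [measurable]: "ball (0::'a) s \<in> sets borel" for s by simp
  have "(\<integral>\<^sup>+x. f x * indicator (ball 0 r) x \<partial>lborel) =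
      (\<integral>\<^sup>+x. f x * indicator (ball 0 r) x \<partial>density (distr lborel borel ((*\<^sub>R) r)) (\<lambda>_. ennreal (r ^ DIM('a))))"
    using lborel_affine[of r "0::'a"] r by simp
  also have "\<dots> = (\<integral>\<^sup>+x. ennreal (r ^ DIM('a)) * (f (r *\<^sub>R x) * indicator (ball 0 r) (r *\<^sub>R x)) \<partial>lborel)"
    by (simp add: nn_integral_density nn_integral_distr)
  also have "\<dots> = (\<integral>\<^sup>+x. ennreal (r ^ DIM('a)) * (f x * indicator (ball 0 1) x) \<partial>lborel)"
    using r by (intro nn_integral_cong) (auto simp: hom indicator_def mult_less_cancel_left2)
  also have "\<dots> = ennreal (r ^ DIM('a)) * (\<integral>\<^sup>+x. f x * indicator (ball 0 1) x \<partial>lborel)"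
    by (rule nn_integral_cmult) measurable
  finally show ?thesis .
qed

text \<open>Both measures \<open>f(x) dx\<close> and \<open>dx\<close> give the ball of radius \<open>r\<close> a multiple of
  \<open>r\<^sup>D\<close>, so their images under the norm are proportional.\<close>
lemma nn_integral_radial_times_homogeneous:
  fixes f :: "'a::euclidean_space \<Rightarrow> ennreal" and g :: "real \<Rightarrow> ennreal"
  assumes f [measurable]: "f \<in> borel_measurable borel"
    and g [measurable]: "g \<in> borel_measurable borel"
    and hom: "\<And>c x. c > 0 \<Longrightarrow> f (c *\<^sub>R x) = f x"
    and fin: "(\<integral>\<^sup>+x. f x * indicator (ball 0 1) x \<partial>lborel) < \<infinity>"
  shows "emeasure lborel (ball (0::'a) 1) * (\<integral>\<^sup>+x. g (norm x) * f x \<partial>lborel) =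
    (\<integral>\<^sup>+x. f x * indicator (ball 0 1) x \<partial>lborel) * (\<integral>\<^sup>+x. g (norm (x::'a)) \<partial>lborel)"
proof -
  define V where "V = emeasure lborel (ball (0::'a) 1)"
  define J where "J = (\<integral>\<^sup>+x. f x * indicator (ball 0 1) x \<partial>lborel)"
  \<comment> \<open>The constants \<open>V\<close> and \<open>J\<close> are crossed so that both
    measures give \<open>{..<r}\<close> the mass V J r^D, where D is the dimension and r >
    0.\<close>
  define M1 where "M1 = distr (density lborel (\<lambda>x. V * f x)) borel norm"
  define M2 where "M2 = distr (density lborel (\<lambda>x::'a. J)) borel norm"
  have vim: "norm -` {..<r} = ball (0::'a) r" for r
    by auto
  have [measurable]: "ball (0::'a) s \<in> sets borel" for s by simp
  have M1: "emeasure M1 {..<r} = V * (\<integral>\<^sup>+x. f x * indicator (ball 0 r) x \<partial>lborel)" for r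
    by (simp add: M1_def emeasure_distr vim emeasure_density mult.assoc nn_integral_cmult)
  have M2: "emeasure M2 {..<r} = J * (\<integral>\<^sup>+x. 1 * indicator (ball (0::'a) r) x \<partial>lborel)" for r
    by (simp add: M2_def emeasure_distr vim emeasure_density nn_integral_cmult)
  have "M1 = M2"
  proof (rule measure_eqI_generator_eq)
    show "Int_stable (range (lessThan :: real \<Rightarrow> _))"
      unfolding Int_stable_def
    proof (clarify)
      fix a b :: real
      have "{..<a} \<inter> {..<b} = {..<min a b}" by auto
      then show "{..<a} \<inter> {..<b} \<in> range lessThan" by simp
    qed
    show "emeasure M1 X = emeasure M2 X" if X: "X \<in> range lessThan" for X
    proof -
      obtain r where r: "X = {..<r}" using X by blast
      show ?thesis
      proof (cases "r > 0")
        case True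
        then show ?thesis
          using nn_integral_homogeneous_ball[OF f hom True]
            nn_integral_homogeneous_ball[of "\<lambda>_::'a. 1", OF _ _ True]
          unfolding r M1 M2 by (simp add: V_def J_def mult_ac)
      qed (simp add: r M1 M2 ball_empty)
    qed
    show "sets M1 = sigma_sets UNIV (range lessThan)" "sets M2 = sigma_sets UNIV (range lessThan)"
      by (simp_all add: M1_def M2_def borel_Iio)
    show "(\<Union>n::nat. {..<real n}) = UNIV"
      using reals_Archimedean2 by auto
    show "emeasure M1 {..<real n} \<noteq> \<infinity>" for n
    proof (cases "n > 0")
      case True
      then show ?thesis
        using nn_integral_homogeneous_ball[OF f hom, of "real n"] fin emeasure_lborel_ball_finite[of "0::'a" 1]
        unfolding M1 by (simp add: V_def ennreal_mult_eq_top_iff top.not_eq_extremum)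
    qed (simp add: M1)
  qed auto
  have "V * (\<integral>\<^sup>+x. g (norm x) * f x \<partial>lborel) = (\<integral>\<^sup>+y. g y \<partial>M1)"
    by (simp add: M1_def nn_integral_distr nn_integral_density mult_ac flip: nn_integral_cmult)
  also have "\<dots> = J * (\<integral>\<^sup>+x. g (norm (x::'a)) \<partial>lborel)"
    by (simp add: \<open>M1 = M2\<close> M2_def nn_integral_distr nn_integral_density nn_integral_cmult)
  finally show ?thesis by (simp add: V_def J_def)
qed

section \<open>Gaussian integrals on the line and on complex n-space\<close>

lemma nn_integral_gaussian:
  assumes c: "c > 0"
  shows "(\<integral>\<^sup>+x. ennreal (exp (- (c * x\<^sup>2))) \<partial>lborel) = ennreal (sqrt (pi / c))"
proof -
  \<comment> \<open>With variance 1 / (2c) the integrand is sqrt (pi / c) times a normal density,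
    whose total mass is 1.\<close>
  define \<sigma> where "\<sigma> = 1 / sqrt (2 * c)"
  have \<sigma>2: "\<sigma>\<^sup>2 = 1 / (2 * c)"
    using c by (simp add: \<sigma>_def power_divide)
  interpret prob_space "density lborel (normal_density 0 \<sigma>)"
    by (rule prob_space_normal_density) (use c in \<open>simp add: \<sigma>_def\<close>)
  have eq: "exp (- (c * x\<^sup>2)) = sqrt (pi / c) * normal_density 0 \<sigma> x" for x
    using c by (simp add: normal_density_def \<sigma>2 real_sqrt_divide mult.commute)
  have "(\<integral>\<^sup>+x. ennreal (exp (- (c * x\<^sup>2))) \<partial>lborel) =
      ennreal (sqrt (pi / c)) * (\<integral>\<^sup>+x. ennreal (normal_density 0 \<sigma> x) \<partial>lborel)"
    unfolding eq using c by (simp add: ennreal_mult normal_density_nonneg nn_integral_cmult)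
  also have "(\<integral>\<^sup>+x. ennreal (normal_density 0 \<sigma> x) \<partial>lborel) = 1"
    using emeasure_space_1 by (simp add: emeasure_density)
  finally show ?thesis by simp
qed

lemma prod_Basis_vec:
  "(\<Prod>b\<in>(Basis :: ('a::euclidean_space^'n) set). g b) = (\<Prod>i\<in>UNIV. \<Prod>u\<in>Basis. g (axis i u))"
proof -
  have "bij_betw (\<lambda>p. axis (fst p) (snd p)) ((UNIV :: 'n set) \<times> Basis) (Basis :: ('a^'n) set)"
    unfolding bij_betw_def
  proof
    show "inj_on (\<lambda>p. axis (fst p) (snd p)) ((UNIV :: 'n set) \<times> (Basis :: 'a set))"
      by (auto simp: inj_on_def axis_eq_axis nonzero_Basis)
    show "(\<lambda>p. axis (fst p) (snd p)) ` ((UNIV :: 'n set) \<times> Basis) = (Basis :: ('a^'n) set)"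
      unfolding Basis_vec_def by (force simp: image_iff axis_eq_axis)
  qed
  from prod.reindex_bij_betw[OF this, of g] show ?thesis
    by (simp add: prod.cartesian_product case_prod_unfold)
qed

lemma nn_integral_gaussian_vec:
  assumes c: "\<And>i. c i > 0"
  shows "(\<integral>\<^sup>+x. ennreal (exp (- (\<Sum>i\<in>UNIV. c i * (norm (x $ i))\<^sup>2))) \<partial>(lborel :: (complex^'n) measure)) =
    ennreal (\<Prod>i\<in>UNIV. pi / c i)"
proof -
  \<comment> \<open>Fubini over the real basis needs a coefficient for each basis vector. A vector
    \<open>axis i u\<close> has one nonzero coordinate, from which \<open>C\<close> recovers
    \<open>i\<close>.\<close>
  define C where "C b = c (SOME i. b $ i \<noteq> 0)" for b :: "complex^'n"
  have C: "C (axis i u) = c i" if "u \<noteq> 0" for i u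
  proof -
    have "(SOME j. axis i u $ j \<noteq> 0) = i"
      using that by (intro some_equality) (auto simp: axis_def split: if_splits)
    then show ?thesis by (simp add: C_def)
  qed
  have nrm: "(norm (x $ i))\<^sup>2 = (\<Sum>u\<in>Basis. (x \<bullet> axis i u)\<^sup>2)" for x :: "complex^'n" and i
    by (simp add: inner_axis Basis_complex_def inner_complex_def cmod_power2)
  have "C (axis i u) = c i" if "u \<in> Basis" for i u
    using C nonzero_Basis that by blast
  then have "ennreal (exp (- (\<Sum>i\<in>UNIV. c i * (norm (x $ i))\<^sup>2))) =
      (\<Prod>b\<in>Basis. ennreal (exp (- (C b * (x \<bullet> b)\<^sup>2))))" for x :: "complex^'n"
    by (simp add: prod_Basis_vec prod_ennreal nrm sum_distrib_left exp_sum prod_nonneg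
        flip: sum_negf cong: prod.cong)
  then have "(\<integral>\<^sup>+x. ennreal (exp (- (\<Sum>i\<in>UNIV. c i * (norm (x $ i))\<^sup>2))) \<partial>(lborel :: (complex^'n) measure)) =
    (\<Prod>b\<in>(Basis :: (complex^'n) set). \<integral>\<^sup>+y. ennreal (exp (- (C b * y\<^sup>2))) \<partial>lborel)"
    by (simp only:) (rule nn_integral_lborel_prod, auto)
  also have "\<dots> = (\<Prod>i\<in>UNIV. \<Prod>u\<in>(Basis::complex set). ennreal (sqrt (pi / c i)))"
    unfolding prod_Basis_vec
    by (intro prod.cong refl) (auto simp: C nonzero_Basis nn_integral_gaussian c)
  \<comment> \<open>Each complex coordinate has two real directions, so the square root appears
    twice.\<close>
  also have "\<dots> = ennreal (\<Prod>i\<in>UNIV. pi / c i)"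
    using c by (simp add: prod_ennreal less_imp_le ennreal_power)
  finally show ?thesis .
qed

section \<open>Complete symmetric polynomials in terms of power sums\<close>

unbundle no vec_syntax
unbundle fps_syntax

text \<open>The product form is what the Gaussian integral yields, and its logarithmic derivative is
  immediate.\<close>

definition complete_sym :: "('n::finite \<Rightarrow> real) \<Rightarrow> real fps" where
  "complete_sym s = (\<Prod>i\<in>UNIV. inverse (1 - fps_const (s i) * fps_X))"

lemma inverse_one_minus_const_fps_X:
  "inverse (1 - fps_const c * fps_X) = Abs_fps (\<lambda>m. (c :: 'a::field) ^ m)"
proof (rule fps_inverse_unique, rule fps_ext)
  show "((1 - fps_const c * fps_X) * Abs_fps (\<lambda>m. c ^ m)) $ n = 1 $ n" for n
    by (cases n) (simp_all add: left_diff_distrib mult.assoc fps_mult_fps_X_commute)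
qed

text \<open>Additivity of logarithmic derivatives, written as f' = f r to avoid dividing power
  series.\<close>

lemma fps_deriv_prod_log:
  fixes f :: "'i \<Rightarrow> 'a::comm_ring_1 fps"
  assumes "\<And>i. i \<in> I \<Longrightarrow> fps_deriv (f i) = f i * r i"
  shows "fps_deriv (\<Prod>i\<in>I. f i) = (\<Prod>i\<in>I. f i) * (\<Sum>i\<in>I. r i)"
  using assms by (induction I rule: infinite_finite_induct) (auto simp: algebra_simps)

text \<open>Coefficient m of F' = F R expresses F_(m+1) through F_0, ..., F_m and R_0, ..., R_m.
  Demanding agreement of \<open>R\<close> and \<open>R'\<close> only below \<open>k\<close> permits
  comparison with a truncated exponential.\<close>

lemma fps_nth_eq_of_log_deriv:
  fixes F G :: "'a::field_char_0 fps"
  assumes F: "fps_deriv F = F * R" and G: "fps_deriv G = G * R'" and 0: "F $ 0 = G $ 0"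
    and R: "\<And>i. i < k \<Longrightarrow> R $ i = R' $ i"
  shows "F $ k = G $ k"
  using R
proof (induction k rule: less_induct)
  case (less k)
  show ?case
  proof (cases k)
    case (Suc m)
    have "of_nat (Suc m) * F $ Suc m = (F * R) $ m"
      using arg_cong[OF F, of "\<lambda>f. f $ m"] by simp
    also have "\<dots> = (G * R') $ m"
      unfolding fps_mult_nth using less Suc by (intro sum.cong) auto
    also have "\<dots> = of_nat (Suc m) * G $ Suc m"
      using arg_cong[OF G, of "\<lambda>f. f $ m"] by simp
    finally show ?thesis
      unfolding Suc using of_nat_neq_0 by (metis mult_left_cancel)
  qed (simp add: 0)
qed

lemma fps_prod_nth_0: "(\<Prod>i\<in>I. f i) $ 0 = (\<Prod>i\<in>I. f i $ 0)" for f :: "'i \<Rightarrow> 'a::comm_ring_1 fps"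
  by (induction I rule: infinite_finite_induct) auto

lemma complete_sym_nth_0 [simp]: "complete_sym s $ 0 = 1"
  by (simp add: complete_sym_def fps_prod_nth_0)

text \<open>The logarithmic derivative of 1 / (1 - cX) is c / (1 - cX), with coefficients c^(m+1);
  summing over the variables produces power sums.\<close>

lemma fps_deriv_complete_sym:
  "fps_deriv (complete_sym s) = complete_sym s * Abs_fps (\<lambda>m. \<Sum>i\<in>UNIV. s i ^ Suc m)"
proof -
  have "fps_deriv (inverse (1 - fps_const c * fps_X)) =
      inverse (1 - fps_const c * fps_X) * (fps_const c * inverse (1 - fps_const c * fps_X))" for c :: real
    by (subst fps_inverse_deriv) (auto simp: power2_eq_square mult_ac)
  from fps_deriv_prod_log[OF this] have "fps_deriv (complete_sym s) =
      complete_sym s * (\<Sum>i\<in>UNIV. fps_const (s i) * inverse (1 - fps_const (s i) * fps_X))"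
    unfolding complete_sym_def .
  also have "(\<Sum>i\<in>UNIV. fps_const (s i) * inverse (1 - fps_const (s i) * fps_X)) =
      Abs_fps (\<lambda>m. \<Sum>i\<in>UNIV. s i ^ Suc m)"
    by (rule fps_ext) (simp add: inverse_one_minus_const_fps_X fps_sum_nth)
  finally show ?thesis .
qed

text \<open>Another factor 1 / (1 - X) turns coefficients into partial sums, which the hockey-stick
  identity evaluates.\<close>

lemma inverse_one_minus_fps_X_power_nth:
  "(inverse (1 - fps_X) ^ Suc n :: 'a::field fps) $ k = of_nat ((n + k) choose k)"
proof (induction n arbitrary: k)
  case (Suc n)
  have "(inverse (1 - fps_X) ^ Suc (Suc n) :: 'a fps) $ k =
      (inverse (1 - fps_X) ^ Suc n * inverse (1 - fps_X)) $ k"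
    by (simp add: mult.commute)
  also have "\<dots> = (\<Sum>i=0..k. of_nat ((n + i) choose i))"
    unfolding fps_mult_nth Suc by (simp add: fps_inverse_one_minus_fps_X)
  also have "\<dots> = of_nat ((Suc n + k) choose k)"
    by (simp only: atLeast0AtMost sum_choose_lower flip: of_nat_sum) simp
  finally show ?case .
qed (simp add: fps_inverse_one_minus_fps_X)

lemma complete_sym_one_nth:
  "complete_sym (\<lambda>_::'n::finite. 1) $ k = real ((CARD('n) + k - 1) choose k)"
proof -
  obtain n where "CARD('n) = Suc n"
    using zero_less_card_finite gr0_implies_Suc by blast
  then show ?thesis
    using inverse_one_minus_fps_X_power_nth[of n k, where 'a=real]
    by (simp add: complete_sym_def del: power_Suc)
qed

section \<open>Coefficients of products of exponentials\<close>

text \<open>Partitions of \<open>n\<close> with parts in \<open>I\<close>, encoded by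
  multiplicities: \<open>m i\<close> counts the parts equal to \<open>i\<close>. Vanishing outside
  \<open>I\<close> makes the encoding unique.\<close>

definition mult_funs :: "nat set \<Rightarrow> nat \<Rightarrow> (nat \<Rightarrow> nat) set" where
  "mult_funs I n = {m. (\<forall>i. i \<notin> I \<longrightarrow> m i = 0) \<and> (\<Sum>i\<in>I. i * m i) = n}"

text \<open>The power series \<open>exp (a X\<^sup>i)\<close>.\<close>
definition exp_monom :: "real \<Rightarrow> nat \<Rightarrow> real fps" where
  "exp_monom a i = Abs_fps (\<lambda>n. if i dvd n then a ^ (n div i) / fact (n div i) else 0)"

text \<open>Coefficient \<open>n\<close> involves the index \<open>n + 1\<close> on the left and
  \<open>n - (i - 1)\<close> on the right. For n >= i - 1 these differ by \<open>i\<close>, so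
  \<open>i\<close> divides both or neither; for smaller \<open>n\<close> both sides vanish.\<close>

lemma fps_deriv_exp_monom:
  assumes "i > 0"
  shows "fps_deriv (exp_monom a i) = exp_monom a i * (fps_const (real i * a) * fps_X ^ (i - 1))"
proof (rule fps_ext)
  fix n
  have rhs: "(exp_monom a i * (fps_const (real i * a) * fps_X ^ (i - 1))) $ n =
      (if n < i - 1 then 0 else real i * a * exp_monom a i $ (n - (i - 1)))"
    by (simp add: fps_X_power_mult_right_nth flip: mult.assoc mult.commute[of "fps_const _"])
  show "fps_deriv (exp_monom a i) $ n =
      (exp_monom a i * (fps_const (real i * a) * fps_X ^ (i - 1))) $ n"
  proof (cases "i dvd Suc n")
    case True
    then obtain q where q: "Suc n = i * Suc q"
      by (metis dvdE mult_0_right nat.distinct(1) not0_implies_Suc)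
    then have n: "n - (i - 1) = i * q" "\<not> n < i - 1"
      using assms by (cases i; simp)+
    have "real (Suc n) = real i * real (Suc q)"
      unfolding q by (rule of_nat_mult)
    moreover have "x * y * (a * b / (y * c)) = x * a * (b / c)" if "y \<noteq> 0" for x y b c :: real
      using that by simp
    ultimately have "real (Suc n) * (a ^ Suc q / fact (Suc q)) = real i * a * (a ^ q / fact q)"
      by (simp only: fact_Suc power_Suc of_nat_neq_0 not_False_eq_True)
    moreover have "Suc n div i = Suc q"
      using assms by (simp add: q del: mult_Suc_right)
    ultimately show ?thesis
      unfolding rhs using assms True n by (simp add: exp_monom_def del: of_nat_Suc fact_Suc power_Suc)
  next
    case False
    moreover have "Suc n = (n - (i - 1)) + i" if "\<not> n < i - 1"
      using that assms by simp
    ultimately have "\<not> i dvd n - (i - 1)" if "\<not> n < i - 1"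
      using that by (metis dvd_add_triv_right_iff)
    with False show ?thesis
      unfolding rhs by (simp add: exp_monom_def)
  qed
qed

text \<open>Choosing the term of order \<open>m i\<close> in the exponential series of each factor
  contributes \<open>i * m i\<close> to the exponent of X.\<close>

lemma prod_exp_monom_nth:
  assumes "finite I" "0 \<notin> I"
  shows "(\<Prod>i\<in>I. exp_monom (a i) i) $ n =
    (\<Sum>m\<in>mult_funs I n. \<Prod>i\<in>I. a i ^ m i / fact (m i))"
  using assms
proof (induction I arbitrary: n rule: finite_induct)
  case empty
  have "mult_funs {} n = (if n = 0 then {\<lambda>_. 0} else {})"
    by (auto simp: mult_funs_def)
  then show ?case by simp
next
  case (insert j I)
  have j: "j > 0" using insert.prems by auto
  have IH: "(\<Prod>i\<in>I. exp_monom (a i) i) $ n = (\<Sum>m\<in>mult_funs I n. \<Prod>i\<in>I. a i ^ m i / fact (m i))" for n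
    using insert by auto
  have fin: "finite (mult_funs I n)" for n
  proof (rule finite_subset)
    show "mult_funs I n \<subseteq> {m. \<forall>i. (i \<in> I \<longrightarrow> m i \<in> {..n}) \<and> (i \<notin> I \<longrightarrow> m i = 0)}"
    proof (clarsimp simp: mult_funs_def)
      fix m i assume i: "i \<in> I"
      have "m i \<le> i * m i" using i insert.prems by (cases i) auto
      also have "\<dots> \<le> (\<Sum>i\<in>I. i * m i)"
        by (rule member_le_sum) (use i insert in auto)
      finally show "m i \<le> (\<Sum>i\<in>I. i * m i)" .
    qed
    show "finite {m. \<forall>i. (i \<in> I \<longrightarrow> m i \<in> {..n}) \<and> (i \<notin> I \<longrightarrow> m i = (0::nat))}"
      by (rule finite_set_of_finite_funs) (use insert in auto)
  qed
  have "(\<Prod>i\<in>insert j I. exp_monom (a i) i) $ n =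
      (\<Sum>u=0..n. exp_monom (a j) j $ u * (\<Prod>i\<in>I. exp_monom (a i) i) $ (n - u))"
    using insert by (simp add: fps_mult_nth)
  also have "\<dots> = (\<Sum>u | u \<le> n \<and> j dvd u. exp_monom (a j) j $ u * (\<Prod>i\<in>I. exp_monom (a i) i) $ (n - u))"
    by (rule sum.mono_neutral_right) (auto simp: exp_monom_def)
  also have "\<dots> = (\<Sum>u | u \<le> n \<and> j dvd u. \<Sum>m\<in>mult_funs I (n - u).
      a j ^ (u div j) / fact (u div j) * (\<Prod>i\<in>I. a i ^ m i / fact (m i)))"
    unfolding IH by (intro sum.cong refl) (simp add: exp_monom_def sum_distrib_left)
  also have "\<dots> = (\<Sum>(u, m)\<in>(SIGMA u:{u. u \<le> n \<and> j dvd u}. mult_funs I (n - u)).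
      a j ^ (u div j) / fact (u div j) * (\<Prod>i\<in>I. a i ^ m i / fact (m i)))"
    by (rule sum.Sigma) (auto simp: fin)
  also have "\<dots> = (\<Sum>m\<in>mult_funs (insert j I) n. \<Prod>i\<in>insert j I. a i ^ m i / fact (m i))"
  \<comment> \<open>Here \<open>u\<close> is the share of \<open>n\<close> taken by the new index
    \<open>j\<close>, so its multiplicity is \<open>u div j\<close>.\<close>
  proof (rule sum.reindex_bij_witness[where i = "\<lambda>m. (j * m j, m(j := 0))" and j = "\<lambda>(u, m). m(j := u div j)"])
    fix m assume m: "m \<in> mult_funs (insert j I) n"
    then have "j * m j + (\<Sum>i\<in>I. i * m i) = n"
      using insert by (simp add: mult_funs_def)
    moreover have "(\<Sum>i\<in>I. i * (m(j := 0)) i) = (\<Sum>i\<in>I. i * m i)"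
      using insert by (intro sum.cong) auto
    ultimately show "(j * m j, m(j := 0)) \<in> (SIGMA u:{u. u \<le> n \<and> j dvd u}. mult_funs I (n - u))"
      using m by (auto simp: mult_funs_def)
    show "(case (j * m j, m(j := 0)) of (u, m) \<Rightarrow> m(j := u div j)) = m"
      using j by simp
  next
    fix p assume p: "p \<in> (SIGMA u:{u. u \<le> n \<and> j dvd u}. mult_funs I (n - u))"
    then obtain q m where q: "p = (j * q, m)" "j * q \<le> n" and m: "m \<in> mult_funs I (n - j * q)"
      by (auto elim!: dvdE)
    have mj: "m j = 0" using m insert by (auto simp: mult_funs_def)
    have "(\<Sum>i\<in>I. i * (m(j := q)) i) = (\<Sum>i\<in>I. i * m i)"
      using insert by (intro sum.cong) auto
    then show "(case p of (u, m) \<Rightarrow> m(j := u div j)) \<in> mult_funs (insert j I) n"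
      using q m j insert by (auto simp: mult_funs_def)
    show "(j * (case p of (u, m) \<Rightarrow> m(j := u div j)) j, (case p of (u, m) \<Rightarrow> m(j := u div j))(j := 0)) = p"
      using q mj j by auto
    have "(\<Prod>i\<in>I. a i ^ (m(j := q)) i / fact ((m(j := q)) i)) = (\<Prod>i\<in>I. a i ^ m i / fact (m i))"
      using insert by (intro prod.cong) auto
    then show "(\<Prod>i\<in>insert j I. a i ^ (case p of (u, m) \<Rightarrow> m(j := u div j)) i / fact ((case p of (u, m) \<Rightarrow> m(j := u div j)) i)) =
        (case p of (u, m) \<Rightarrow> a j ^ (u div j) / fact (u div j) * (\<Prod>i\<in>I. a i ^ m i / fact (m i)))"
      using insert q j by simp
  qed
  finally show ?case .
qed

theorem complete_sym_nth_power_sums: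
  "complete_sym s $ k = (\<Sum>m\<in>mult_funs {1..k} k. \<Prod>i=1..k. ((\<Sum>j\<in>UNIV. s j ^ i) / real i) ^ m i / fact (m i))"
proof -
  define p where "p i = (\<Sum>j\<in>UNIV. s j ^ i)" for i
  \<comment> \<open>The exponential of the power-sum series cut off at degree \<open>k\<close>. Its
    logarithmic derivative is correct below degree \<open>k\<close>, which suffices for coefficient
    \<open>k\<close>.\<close>
  define E where "E = (\<Prod>i=1..k. exp_monom (p i / real i) i)"
  have E1: "fps_deriv E = E * (\<Sum>i=1..k. fps_const (p i) * fps_X ^ (i - 1))"
    unfolding E_def by (rule fps_deriv_prod_log) (simp add: fps_deriv_exp_monom)
  have E2: "(\<Sum>i=1..k. fps_const (p i) * fps_X ^ (i - 1)) $ n = Abs_fps (\<lambda>m. p (Suc m)) $ n" if "n < k" for n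
  proof -
    have "(\<Sum>i=1..k. fps_const (p i) * fps_X ^ (i - 1)) $ n = (\<Sum>i=1..k. if i = Suc n then p i else 0)"
      unfolding fps_sum_nth by (intro sum.cong refl) (case_tac x; auto)
    also have "\<dots> = p (Suc n)"
      using that by simp
    finally show ?thesis by simp
  qed
  have E3: "E $ 0 = 1"
    by (simp add: E_def fps_prod_nth_0 exp_monom_def)
  have "E $ k = complete_sym s $ k"
    by (rule fps_nth_eq_of_log_deriv[OF E1 fps_deriv_complete_sym])
      (use E2 E3 in \<open>simp_all add: p_def\<close>)
  then show ?thesis
    by (simp add: E_def prod_exp_monom_nth p_def)
qed

section \<open>Partitions and their multiplicities\<close>

definition partitions_of :: "nat \<Rightarrow> (nat \<Rightarrow> nat) set" where
  "partitions_of k = {\<beta>. (\<forall>i. i \<notin> {1..k} \<longrightarrow> \<beta> i = 0) \<and>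
     (\<forall>i\<in>{1..k}. \<forall>j\<in>{1..k}. i \<le> j \<longrightarrow> \<beta> j \<le> \<beta> i) \<and> (\<Sum>i=1..k. \<beta> i) = k}"

lemma partitions_ofI:
  assumes "\<And>i. i \<notin> {1..k} \<Longrightarrow> \<beta> i = 0"
    and "\<And>i j. i \<in> {1..k} \<Longrightarrow> j \<in> {1..k} \<Longrightarrow> i \<le> j \<Longrightarrow> \<beta> j \<le> \<beta> i"
    and "(\<Sum>i=1..k. \<beta> i) = k"
  shows "\<beta> \<in> partitions_of k"
  using assms unfolding partitions_of_def by blast

text \<open>Rows and columns of a Young diagram are such initial segments, so their sizes determine
  them.\<close>

lemma downset_eq_atLeastAtMost_card:
  assumes S: "S \<subseteq> {1..k::nat}" and down: "\<And>i j. j \<in> S \<Longrightarrow> 1 \<le> i \<Longrightarrow> i \<le> j \<Longrightarrow> i \<in> S"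
  shows "S = {1..card S}"
proof (cases "S = {}")
  case False
  have fin: "finite S" using S finite_subset by blast
  have "S = {1..Max S}"
  proof
    show "S \<subseteq> {1..Max S}"
      using S fin by auto
    show "{1..Max S} \<subseteq> S"
      using down[OF Max_in[OF fin False]] by auto
  qed
  then show ?thesis by (metis card_atLeastAtMost diff_Suc_1 One_nat_def)
qed simp

lemma partitions_of_le:
  assumes "\<beta> \<in> partitions_of k"
  shows "\<beta> j \<le> k"
proof (cases "j \<in> {1..k}")
  case True
  then have "\<beta> j \<le> (\<Sum>i=1..k. \<beta> i)"
    by (intro member_le_sum) auto
  with assms show ?thesis by (simp add: partitions_of_def)
qed (use assms in \<open>auto simp: partitions_of_def\<close>)

text \<open>The cardinality is part \<open>i\<close> of the conjugate partition; both sides say that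
  the cell (i, j) lies in the Young diagram.\<close>

lemma le_partition_iff:
  assumes \<beta>: "\<beta> \<in> partitions_of k" and i: "i \<ge> 1" and j: "j \<in> {1..k}"
  shows "i \<le> \<beta> j \<longleftrightarrow> j \<le> card {j \<in> {1..k}. i \<le> \<beta> j}"
proof -
  let ?S = "{j \<in> {1..k}. i \<le> \<beta> j}"
  have "?S = {1..card ?S}"
  proof (rule downset_eq_atLeastAtMost_card)
    show "j' \<in> ?S" if "l \<in> ?S" "1 \<le> j'" "j' \<le> l" for j' l
    proof -
      have "\<beta> l \<le> \<beta> j'" using \<beta> that by (auto simp: partitions_of_def)
      with that show ?thesis by auto
    qed
  qed auto
  then have "j \<in> ?S \<longleftrightarrow> j \<in> {1..card ?S}" by simp
  with j show ?thesis by simp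
qed

lemma prod_partition_eq_prod_part_mult:
  fixes f :: "nat \<Rightarrow> 'a::comm_monoid_mult"
  assumes "\<beta> \<in> partitions_of k"
  shows "(\<Prod>j | j \<in> {1..k} \<and> \<beta> j \<noteq> 0. f (\<beta> j)) = (\<Prod>i=1..k. f i ^ part_mult k \<beta> i)"
proof -
  let ?S = "{j. j \<in> {1..k} \<and> \<beta> j \<noteq> 0}"
  have "(\<Prod>j\<in>?S. f (\<beta> j)) = (\<Prod>i=1..k. \<Prod>j\<in>{j \<in> ?S. \<beta> j = i}. f (\<beta> j))"
    by (rule prod.group[symmetric]) (use partitions_of_le[OF assms] in \<open>auto simp: Suc_le_eq\<close>)
  also have "\<dots> = (\<Prod>i=1..k. f i ^ part_mult k \<beta> i)"
  proof (rule prod.cong)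
    fix i assume "i \<in> {1..k}"
    then have "{j \<in> ?S. \<beta> j = i} = {j \<in> {1..k}. \<beta> j = i}" by auto
    then show "(\<Prod>j\<in>{j \<in> ?S. \<beta> j = i}. f (\<beta> j)) = f i ^ part_mult k \<beta> i"
      by (simp add: part_mult_def)
  qed simp
  finally show ?thesis .
qed

lemma sum_partition_eq_sum_part_mult:
  assumes "\<beta> \<in> partitions_of k"
  shows "(\<Sum>i=1..k. i * part_mult k \<beta> i) = k"
proof -
  have "k = (\<Sum>j=1..k. \<beta> j)"
    using assms by (simp add: partitions_of_def)
  \<comment> \<open>The value 0 must be among the classes because tuples are padded with zeros; its
    class contributes nothing.\<close>
  also have "\<dots> = (\<Sum>i\<in>{0..k}. \<Sum>j\<in>{j \<in> {1..k}. \<beta> j = i}. \<beta> j)"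
    by (rule sum.group[symmetric]) (use partitions_of_le[OF assms] in auto)
  also have "\<dots> = (\<Sum>i\<in>{0..k}. i * part_mult k \<beta> i)"
    by (intro sum.cong refl) (simp add: part_mult_def)
  also have "\<dots> = (\<Sum>i=1..k. i * part_mult k \<beta> i)"
    by (simp add: sum.atLeast_Suc_atMost)
  finally show ?thesis by simp
qed

section \<open>The bijection between partitions and multiplicity functions\<close>

text \<open>The cut-off removes \<open>part_mult k \<beta> 0\<close>, which counts the padding
  zeros.\<close>

definition mult_of_part :: "nat \<Rightarrow> (nat \<Rightarrow> nat) \<Rightarrow> nat \<Rightarrow> nat" where
  "mult_of_part k \<beta> i = (if i \<in> {1..k} then part_mult k \<beta> i else 0)"

text \<open>The sum is the number of parts \<open>\<ge> i\<close>, so this is the conjugate of the conjugate partition.\<close>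
definition part_of_mult :: "nat \<Rightarrow> (nat \<Rightarrow> nat) \<Rightarrow> nat \<Rightarrow> nat" where
  "part_of_mult k m j = (if j \<in> {1..k} then card {i \<in> {1..k}. j \<le> (\<Sum>i'=i..k. m i')} else 0)"

lemma mult_of_part_in_mult_funs:
  "\<beta> \<in> partitions_of k \<Longrightarrow> mult_of_part k \<beta> \<in> mult_funs {1..k} k"
  using sum_partition_eq_sum_part_mult[of \<beta> k] by (simp add: mult_funs_def mult_of_part_def)

text \<open>Tail sums of the multiplicities are the parts of the conjugate partition.\<close>

lemma sum_mult_of_part:
  assumes "\<beta> \<in> partitions_of k" "i \<ge> 1"
  shows "(\<Sum>i'=i..k. mult_of_part k \<beta> i') = card {j \<in> {1..k}. i \<le> \<beta> j}"
proof -
  have "card {j \<in> {1..k}. i \<le> \<beta> j} = card (\<Union>i'\<in>{i..k}. {j \<in> {1..k}. \<beta> j = i'})"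
    using partitions_of_le[OF assms(1)] by (intro arg_cong[of _ _ card]) auto
  also have "\<dots> = (\<Sum>i'=i..k. part_mult k \<beta> i')"
    unfolding part_mult_def by (rule card_UN_disjoint) auto
  also have "\<dots> = (\<Sum>i'=i..k. mult_of_part k \<beta> i')"
    using assms(2) by (intro sum.cong) (auto simp: mult_of_part_def)
  finally show ?thesis by simp
qed

lemma part_of_mult_mult_of_part:
  assumes \<beta>: "\<beta> \<in> partitions_of k"
  shows "part_of_mult k (mult_of_part k \<beta>) = \<beta>"
proof
  fix j
  show "part_of_mult k (mult_of_part k \<beta>) j = \<beta> j"
  proof (cases "j \<in> {1..k}")
    case True
    have "{i \<in> {1..k}. j \<le> (\<Sum>i'=i..k. mult_of_part k \<beta> i')} = {i \<in> {1..k}. i \<le> \<beta> j}"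
      using True by (auto simp: sum_mult_of_part[OF \<beta>] le_partition_iff[OF \<beta> _ True])
    also have "\<dots> = {1..\<beta> j}"
      using partitions_of_le[OF \<beta>, of j] by auto
    finally show ?thesis
      using True by (simp add: part_of_mult_def)
  next
    case False
    then show ?thesis using \<beta> by (auto simp: part_of_mult_def partitions_of_def)
  qed
qed

text \<open>The counterpart of \<open>le_partition_iff\<close> on the multiplicity side. It covers i
  > k, where both sides are false; the instance \<open>Suc k\<close> occurs when consecutive tail
  sums are subtracted.\<close>

lemma le_part_of_mult_iff:
  assumes i: "i \<ge> 1" and j: "j \<in> {1..k}"
  shows "i \<le> part_of_mult k m j \<longleftrightarrow> j \<le> (\<Sum>i'=i..k. m i')"
proof -
  let ?S = "{i \<in> {1..k}. j \<le> (\<Sum>i'=i..k. m i')}"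
  have S: "?S = {1..card ?S}"
  proof (rule downset_eq_atLeastAtMost_card)
    show "i' \<in> ?S" if "l \<in> ?S" "1 \<le> i'" "i' \<le> l" for i' l
    proof -
      have "(\<Sum>i'=l..k. m i') \<le> (\<Sum>i'=i'..k. m i')"
        using that by (intro sum_mono2) auto
      with that show ?thesis by auto
    qed
  qed auto
  have "i \<le> part_of_mult k m j \<longleftrightarrow> i \<in> {1..card ?S}"
    using i j by (simp add: part_of_mult_def)
  also have "\<dots> \<longleftrightarrow> i \<in> ?S" using S by simp
  also have "\<dots> \<longleftrightarrow> j \<le> (\<Sum>i'=i..k. m i')"
    using i j by (cases "i \<le> k") auto
  finally show ?thesis .
qed

text \<open>A partition of \<open>k\<close> has at most \<open>k\<close> parts, so cutting tuples
  off at position \<open>k\<close> loses nothing.\<close>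

lemma sum_mult_funs_le:
  assumes "m \<in> mult_funs {1..k} k" "i \<ge> 1"
  shows "(\<Sum>i'=i..k. m i') \<le> k"
proof -
  have "(\<Sum>i'=i..k. m i') \<le> (\<Sum>i'=1..k. m i')"
    using assms by (intro sum_mono2) auto
  also have "\<dots> \<le> (\<Sum>i'=1..k. i' * m i')"
    by (intro sum_mono) auto
  finally show ?thesis using assms by (simp add: mult_funs_def)
qed

text \<open>Double counting of cells: the entries add up to the sum of all tail sums, in which
  \<open>m i'\<close> occurs once for each i = 1, ..., i', that is \<open>i'\<close> times.\<close>

lemma part_of_mult_in_partitions_of:
  assumes m: "m \<in> mult_funs {1..k} k"
  shows "part_of_mult k m \<in> partitions_of k"
proof -
  have "part_of_mult k m j \<le> part_of_mult k m i" if "i \<in> {1..k}" "j \<in> {1..k}" "i \<le> j" for i j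
    using that unfolding part_of_mult_def by (auto intro!: card_mono)
  moreover have "(\<Sum>j=1..k. part_of_mult k m j) = k"
  proof -
    have "(\<Sum>j=1..k. part_of_mult k m j) = (\<Sum>j=1..k. \<Sum>i=1..k. if j \<le> (\<Sum>i'=i..k. m i') then 1 else 0)"
      by (intro sum.cong refl) (simp add: part_of_mult_def sum.If_cases Int_def)
    also have "\<dots> = (\<Sum>i=1..k. \<Sum>j=1..k. if j \<le> (\<Sum>i'=i..k. m i') then 1 else 0)"
      by (rule sum.swap)
    also have "\<dots> = (\<Sum>i=1..k. \<Sum>i'=i..k. m i')"
    proof (rule sum.cong[OF refl])
      fix i assume "i \<in> {1..k}"
      then have "{1..k} \<inter> {j. j \<le> (\<Sum>i'=i..k. m i')} = {1..\<Sum>i'=i..k. m i'}"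
        using sum_mult_funs_le[OF m, of i] by auto
      then show "(\<Sum>j=1..k. if j \<le> (\<Sum>i'=i..k. m i') then 1 else 0 :: nat) = (\<Sum>i'=i..k. m i')"
        by (simp add: sum.If_cases)
    qed
    also have "\<dots> = (\<Sum>i=1..k. \<Sum>i'=1..k. if i \<le> i' then m i' else 0)"
      by (rule sum.cong[OF refl], simp add: sum.If_cases, rule sum.cong) auto
    also have "\<dots> = (\<Sum>i'=1..k. \<Sum>i=1..k. if i \<le> i' then m i' else 0)"
      by (rule sum.swap)
    also have "\<dots> = (\<Sum>i'=1..k. i' * m i')"
    proof (intro sum.cong refl)
      fix i' assume "i' \<in> {1..k}"
      then have "{1..k} \<inter> {i. i \<le> i'} = {1..i'}" by auto
      then show "(\<Sum>i=1..k. if i \<le> i' then m i' else 0) = i' * m i'"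
        by (simp add: sum.If_cases)
    qed
    finally show ?thesis using m by (simp add: mult_funs_def)
  qed
  moreover have "part_of_mult k m i = 0" if "i \<notin> {1..k}" for i
    unfolding part_of_mult_def using that by (rule if_not_P)
  ultimately show ?thesis by (intro partitions_ofI)
qed

text \<open>The positions whose entry is exactly \<open>i\<close> lie between consecutive tail sums,
  and these differ by \<open>m i\<close>.\<close>

lemma mult_of_part_part_of_mult:
  assumes m: "m \<in> mult_funs {1..k} k"
  shows "mult_of_part k (part_of_mult k m) = m"
proof
  fix i
  show "mult_of_part k (part_of_mult k m) i = m i"
  proof (cases "i \<in> {1..k}")
    case True
    let ?c = "\<lambda>i. \<Sum>i'=i..k. m i'"
    have "{j \<in> {1..k}. part_of_mult k m j = i} =
        {j \<in> {1..k}. i \<le> part_of_mult k m j} - {j \<in> {1..k}. Suc i \<le> part_of_mult k m j}"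
      by auto
    also have "\<dots> = {j \<in> {1..k}. j \<le> ?c i} - {j \<in> {1..k}. j \<le> ?c (Suc i)}"
      using True by (auto simp: le_part_of_mult_iff simp del: Suc_le_eq)
    also have "\<dots> = {?c (Suc i)<..?c i}"
      using True sum_mult_funs_le[OF m, of i] by auto
    finally have "part_mult k (part_of_mult k m) i = ?c i - ?c (Suc i)"
      by (simp add: part_mult_def)
    moreover have "?c i = m i + ?c (Suc i)"
      using True by (intro sum.atLeast_Suc_atMost) simp
    ultimately show ?thesis
      using True by (simp add: mult_of_part_def)
  next
    case False
    have "m i = 0"
      using m False unfolding mult_funs_def by blast
    with False show ?thesis
      by (auto simp: mult_of_part_def)
  qed
qed

lemma partitions_with_parts_support:
  assumes "\<beta> \<in> partitions_with_parts k l" "l \<in> {1..k}"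
  shows "{j. j \<in> {1..k} \<and> \<beta> j \<noteq> 0} = {1..l}"
proof (intro equalityI subsetI)
  fix j assume "j \<in> {1..l}"
  then have "\<beta> l \<le> \<beta> j" "\<beta> l \<noteq> 0" "j \<in> {1..k}"
    using assms by (auto simp: partitions_with_parts_def)
  then show "j \<in> {j. j \<in> {1..k} \<and> \<beta> j \<noteq> 0}"
    by simp
next
  fix j assume "j \<in> {j. j \<in> {1..k} \<and> \<beta> j \<noteq> 0}"
  moreover have "\<forall>i>l. \<beta> i = 0"
    using assms unfolding partitions_with_parts_def by blast
  ultimately show "j \<in> {1..l}"
    by (metis (mono_tags, lifting) atLeastAtMost_iff mem_Collect_eq not_le)
qed

lemma partitions_of_in_partitions_with_parts:
  assumes "\<beta> \<in> partitions_of k" "k \<ge> 1"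
  defines "l \<equiv> card {j. j \<in> {1..k} \<and> \<beta> j \<noteq> 0}"
  shows "l \<in> {1..k}" "\<beta> \<in> partitions_with_parts k l"
proof -
  let ?S = "{j. j \<in> {1..k} \<and> \<beta> j \<noteq> 0}"
  have "{j \<in> {1..k}. 1 \<le> \<beta> j} = ?S" by auto
  then have iff: "\<beta> j \<noteq> 0 \<longleftrightarrow> j \<le> l" if "j \<in> {1..k}" for j
    using le_partition_iff[OF assms(1), of 1 j] that by (simp add: l_def Suc_le_eq)
  have "?S \<noteq> {}"
  proof
    assume "?S = {}"
    then have "(\<Sum>j=1..k. \<beta> j) = 0" by (intro sum.neutral) auto
    then show False using assms by (simp add: partitions_of_def)
  qed
  then have "l \<ge> 1" by (simp add: l_def Suc_le_eq card_gt_0_iff)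
  moreover have "l \<le> card {1..k}" unfolding l_def by (intro card_mono) auto
  ultimately show l: "l \<in> {1..k}" by simp
  have "\<beta> i = 0" if "i > l" for i
    using iff[of i] that assms(1) by (cases "i \<in> {1..k}") (auto simp: partitions_of_def)
  with iff[OF l] assms(1) show "\<beta> \<in> partitions_with_parts k l"
    by (simp add: partitions_with_parts_def partitions_of_def)
qed

lemma partitions_with_parts_subset: "partitions_with_parts k l \<subseteq> partitions_of k"
  unfolding partitions_with_parts_def partitions_of_def by blast

lemma finite_partitions_of: "finite (partitions_of k)"
proof (rule finite_subset)
  show "partitions_of k \<subseteq> {\<beta>. \<forall>i. (i \<in> {1..k} \<longrightarrow> \<beta> i \<in> {..k}) \<and> (i \<notin> {1..k} \<longrightarrow> \<beta> i = 0)}"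
  proof (intro subsetI CollectI allI conjI impI)
    show "\<beta> i \<in> {..k}" if "\<beta> \<in> partitions_of k" for \<beta> i
      using partitions_of_le[OF that] by simp
    show "\<beta> i = 0" if "\<beta> \<in> partitions_of k" "i \<notin> {1..k}" for \<beta> i
      using that unfolding partitions_of_def by blast
  qed
  show "finite {\<beta>. \<forall>i. (i \<in> {1..k} \<longrightarrow> \<beta> i \<in> {..k}) \<and> (i \<notin> {1..k} \<longrightarrow> \<beta> i = (0::nat))}"
    by (rule finite_set_of_finite_funs) auto
qed

text \<open>Both z and the product over the parts depend only on the multiplicities, so each summand
  becomes \<open>F \<beta>\<close>. The sets for different \<open>l\<close> then merge into all
  partitions of \<open>k\<close>, with \<open>l\<close> recovered as the number of nonzero
  entries.\<close>

theorem sum_partitions_with_parts: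
  fixes p :: "nat \<Rightarrow> real"
  assumes "k \<ge> 1"
  shows "(\<Sum>l=1..k. \<Sum>\<beta>\<in>partitions_with_parts k l. 1 / real (z_part k \<beta>) * (\<Prod>t=1..l. p (\<beta> t))) =
    (\<Sum>m\<in>mult_funs {1..k} k. \<Prod>i=1..k. (p i / real i) ^ m i / fact (m i))"
proof -
  define F where "F \<beta> = (\<Prod>i=1..k. (p i / real i) ^ part_mult k \<beta> i / fact (part_mult k \<beta> i))" for \<beta>
  have F: "1 / real (z_part k \<beta>) * (\<Prod>t=1..l. p (\<beta> t)) = F \<beta>"
    if "l \<in> {1..k}" "\<beta> \<in> partitions_with_parts k l" for l \<beta>
  proof -
    have "(\<Prod>t=1..l. p (\<beta> t)) = (\<Prod>i=1..k. p i ^ part_mult k \<beta> i)"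
      using prod_partition_eq_prod_part_mult[of \<beta> k p] that partitions_with_parts_subset
      unfolding partitions_with_parts_support[OF that(2,1)] by blast
    then show ?thesis
      by (simp add: F_def z_part_def power_divide prod_dividef prod.distrib mult.commute)
  qed
  have "(\<Sum>l=1..k. \<Sum>\<beta>\<in>partitions_with_parts k l. 1 / real (z_part k \<beta>) * (\<Prod>t=1..l. p (\<beta> t))) =
      (\<Sum>l=1..k. \<Sum>\<beta>\<in>partitions_with_parts k l. F \<beta>)"
    by (intro sum.cong refl F) auto
  also have "\<dots> = (\<Sum>(l, \<beta>)\<in>(SIGMA l:{1..k}. partitions_with_parts k l). F \<beta>)"
    by (rule sum.Sigma) (auto intro: finite_subset[OF partitions_with_parts_subset finite_partitions_of])
  also have "\<dots> = (\<Sum>\<beta>\<in>partitions_of k. F \<beta>)"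
  proof (rule sum.reindex_bij_witness[where j = snd and i = "\<lambda>\<beta>. (card {j. j \<in> {1..k} \<and> \<beta> j \<noteq> 0}, \<beta>)"])
    fix q assume q: "q \<in> (SIGMA l:{1..k}. partitions_with_parts k l)"
    then show "(card {j. j \<in> {1..k} \<and> snd q j \<noteq> 0}, snd q) = q"
      using partitions_with_parts_support[of "snd q" k "fst q"] by (auto simp: prod_eq_iff)
    show "snd q \<in> partitions_of k"
      using q by (auto dest: subsetD[OF partitions_with_parts_subset])
  next
    fix \<beta> assume "\<beta> \<in> partitions_of k"
    then show "(card {j. j \<in> {1..k} \<and> \<beta> j \<noteq> 0}, \<beta>) \<in> (SIGMA l:{1..k}. partitions_with_parts k l)"
      using partitions_of_in_partitions_with_parts[OF _ assms] by blast
  qed auto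
  also have "\<dots> = (\<Sum>m\<in>mult_funs {1..k} k. \<Prod>i=1..k. (p i / real i) ^ m i / fact (m i))"
  proof (rule sum.reindex_bij_witness[where i = "part_of_mult k" and j = "mult_of_part k"])
    show "(\<Prod>i=1..k. (p i / real i) ^ mult_of_part k \<beta> i / fact (mult_of_part k \<beta> i)) = F \<beta>" for \<beta>
      unfolding F_def by (intro prod.cong) (auto simp: mult_of_part_def)
  qed (simp_all del: One_nat_def add: mult_of_part_in_mult_funs part_of_mult_in_partitions_of
      part_of_mult_mult_of_part mult_of_part_part_of_mult)
  finally show ?thesis .
qed

unbundle no fps_syntax
unbundle vec_syntax

section \<open>Gaussian and spherical moments\<close>

text \<open>Dividing a nonzero \<open>D\<close> by its lowest power of X leaves a series with
  nonzero constant term; it would vanish for small t > 0, contradicting continuity at 0.\<close>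

lemma fps_eq_0_of_eval_at_right:
  fixes D :: "real fps"
  assumes conv: "fps_conv_radius D > 0" and ev: "eventually (\<lambda>t. eval_fps D t = 0) (at_right 0)"
  shows "D = 0"
proof (rule ccontr)
  assume "D \<noteq> 0"
  define G where "G = fps_shift (subdegree D) D"
  have G: "fps_conv_radius G > 0"
    using conv by (simp add: G_def)
  have "eventually (\<lambda>t. ereal (norm t) < fps_conv_radius D) (at_right (0::real))"
  proof -
    obtain r where r: "r > 0" "ereal r < fps_conv_radius D"
      using conv ereal_dense2[of 0 "fps_conv_radius D"] by (metis ereal_less(2))
    have "eventually (\<lambda>t. t \<in> {0<..<r}) (at_right (0::real))"
      using r by (intro eventually_at_right_real)
    then show ?thesis
      by eventually_elim (use r in \<open>auto intro: less_trans[of _ "ereal r"]\<close>)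
  qed
  with ev eventually_at_right_less[of "0::real"] have "eventually (\<lambda>t. eval_fps G t = 0) (at_right 0)"
    by eventually_elim (simp add: G_def eval_fps_shift)
  then have "(eval_fps G \<longlongrightarrow> 0) (at_right 0)"
    by (rule tendsto_eventually)
  moreover have "(eval_fps G \<longlongrightarrow> eval_fps G 0) (at_right 0)"
  proof -
    have "isCont (eval_fps G) 0"
      using continuous_eval_fps[of 0 G UNIV] G by (simp add: zero_ereal_def)
    then show ?thesis
      by (metis isCont_def filterlim_at_split)
  qed
  ultimately have "eval_fps G 0 = 0"
    using tendsto_unique trivial_limit_at_right_real by blast
  then show False
    using \<open>D \<noteq> 0\<close> by (simp add: G_def eval_fps_at_0)
qed

lemma norm_vec_power2: "(norm x)\<^sup>2 = (\<Sum>i\<in>UNIV. (norm (x $ i))\<^sup>2)" for x :: "'a::real_normed_vector^'n"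
  by (simp add: norm_vec_def L2_set_def sum_nonneg)

text \<open>Both sides are coefficients of the generating function
  \<open>\<integral> exp (t H - |x|\<^sup>2) dx = \<Prod>\<^sub>i \<pi> / (1 - t s\<^sub>i)\<close> with \<open>H = \<Sum>\<^sub>i s\<^sub>i |x\<^sub>i|\<^sup>2\<close>.\<close>
lemma gaussian_moment_complete_sym:
  fixes s :: "'n::finite \<Rightarrow> real"
  assumes s: "\<And>i. s i \<ge> 0"
  shows "(\<integral>\<^sup>+x. ennreal (exp (- (norm x)\<^sup>2) * (\<Sum>i\<in>UNIV. s i * (norm (x $ i))\<^sup>2) ^ k)
      \<partial>(lborel :: (complex^'n) measure)) = ennreal (pi ^ CARD('n) * fact k * fps_nth (complete_sym s) k)"
proof -
  define H where "H x = (\<Sum>i\<in>UNIV. s i * (norm (x $ i))\<^sup>2)" for x :: "complex^'n"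
  define M where "M k = (\<integral>\<^sup>+x. ennreal (exp (- (norm x)\<^sup>2) * H x ^ k) \<partial>lborel)" for k
  \<comment> \<open>Keeps every Gaussian weight 1 - t s_i positive for 0 <= t <= t0; the added 1
    covers the case that all s_i vanish.\<close>
  define t0 where "t0 = 1 / (1 + (\<Sum>i\<in>UNIV. s i))"
  have H0: "H x \<ge> 0" for x by (simp add: H_def s sum_nonneg)
  have H_meas [measurable]: "H \<in> borel_measurable borel"
    unfolding H_def by (intro borel_measurable_continuous_onI continuous_intros)
  have S0: "(\<Sum>i\<in>UNIV. s i) \<ge> 0" by (simp add: s sum_nonneg)
  then have t0: "t0 > 0" by (simp add: t0_def)
  have ts: "t * s i < 1" if "0 \<le> t" "t \<le> t0" for t i
  proof -
    have "t * s i \<le> t0 * s i" using that s by (simp add: mult_right_mono)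
    also have "s i \<le> (\<Sum>i\<in>UNIV. s i)" by (rule member_le_sum) (use s in auto)
    then have "t0 * s i < 1" using S0 by (simp add: t0_def)
    finally show ?thesis .
  qed
  define g where "g t = (\<Prod>i\<in>UNIV. pi / (1 - t * s i))" for t
  have gen: "(\<Sum>k. ennreal (t ^ k / fact k) * M k) = ennreal (g t)" if t: "0 \<le> t" "t \<le> t0" for t
  proof -
    have ptw: "(\<Sum>k. ennreal (t ^ k / fact k) * ennreal (exp (- (norm x)\<^sup>2) * H x ^ k)) =
        ennreal (exp (- (\<Sum>i\<in>UNIV. (1 - t * s i) * (norm (x $ i))\<^sup>2)))" for x :: "complex^'n"
    proof -
      have "(\<lambda>k. exp (- (norm x)\<^sup>2) * ((t * H x) ^ k /\<^sub>R fact k)) sums (exp (- (norm x)\<^sup>2) * exp (t * H x))"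
        by (intro sums_mult exp_converges)
      then have "(\<lambda>k. t ^ k / fact k * (exp (- (norm x)\<^sup>2) * H x ^ k)) sums (exp (- (norm x)\<^sup>2) * exp (t * H x))"
        by (simp add: power_mult_distrib divide_inverse mult_ac)
      then have "(\<Sum>k. ennreal (t ^ k / fact k * (exp (- (norm x)\<^sup>2) * H x ^ k))) =
          ennreal (exp (- (norm x)\<^sup>2) * exp (t * H x))"
        by (intro suminf_ennreal_eq) (auto simp: t H0)
      moreover have "exp (- (norm x)\<^sup>2) * exp (t * H x) = exp (- (\<Sum>i\<in>UNIV. (1 - t * s i) * (norm (x $ i))\<^sup>2))"
        unfolding exp_add[symmetric] H_def norm_vec_power2
        by (simp add: algebra_simps sum_subtractf sum_distrib_left)
      moreover have "ennreal (t ^ k / fact k) * ennreal (exp (- (norm x)\<^sup>2) * H x ^ k) =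
          ennreal (t ^ k / fact k * (exp (- (norm x)\<^sup>2) * H x ^ k))" for k
        using t by (intro ennreal_mult[symmetric]) (simp_all add: H0)
      ultimately show ?thesis
        by simp
    qed
    have "(\<Sum>k. ennreal (t ^ k / fact k) * M k) =
        (\<Sum>k. \<integral>\<^sup>+x. ennreal (t ^ k / fact k) * ennreal (exp (- (norm x)\<^sup>2) * H x ^ k) \<partial>lborel)"
      unfolding M_def by (intro suminf_cong nn_integral_cmult[symmetric]) measurable
    also have "\<dots> = (\<integral>\<^sup>+x. (\<Sum>k. ennreal (t ^ k / fact k) * ennreal (exp (- (norm x)\<^sup>2) * H x ^ k)) \<partial>lborel)"
      by (rule nn_integral_suminf[symmetric]) measurable
    also have "\<dots> = ennreal (g t)"
      unfolding ptw g_def using ts[OF t] by (intro nn_integral_gaussian_vec) simp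
    finally show ?thesis .
  qed
  \<comment> \<open>Each term of the series at \<open>t0\<close> is bounded by its sum, the finite
    number \<open>g t0\<close>.\<close>
  have "M k < \<infinity>" for k
  proof (rule ccontr)
    assume "\<not> M k < \<infinity>"
    then have "ennreal (t0 ^ k / fact k) * M k = \<infinity>"
      using t0 by (simp add: ennreal_mult_eq_top_iff less_top[symmetric])
    moreover have "ennreal (t0 ^ k / fact k) * M k \<le> (\<Sum>k. ennreal (t0 ^ k / fact k) * M k)"
      using sum_le_suminf[of "\<lambda>k. ennreal (t0 ^ k / fact k) * M k" "{k}"] by simp
    ultimately show False
      using gen[of t0] t0 by (simp add: top_unique)
  qed
  then have M: "M k = ennreal (enn2real (M k))" for k
    by simp
  define F where "F = Abs_fps (\<lambda>k. enn2real (M k) / fact k)"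
  have F_sums: "(\<lambda>k. fps_nth F k * t ^ k) sums g t" if t: "0 \<le> t" "t \<le> t0" for t
  proof -
    have "(\<lambda>k. ennreal (t ^ k / fact k) * M k) sums ennreal (g t)"
      using gen[OF t] by (metis summable_sums summableI)
    then have "(\<lambda>k. ennreal (t ^ k / fact k * enn2real (M k))) sums ennreal (g t)"
      using t by (subst (asm) M) (subst ennreal_mult; simp)
    moreover have "g t \<ge> 0"
      unfolding g_def using ts[OF t] by (intro prod_nonneg) (simp add: less_imp_le)
    ultimately have "(\<lambda>k. t ^ k / fact k * enn2real (M k)) sums g t"
      using t by (subst (asm) sums_ennreal) auto
    then show ?thesis
      by (simp add: F_def mult_ac)
  qed
  have F_conv: "fps_conv_radius F > 0"
  proof -
    have "ereal (norm t0) \<le> fps_conv_radius F"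
      unfolding fps_conv_radius_def using F_sums[of t0] t0 by (intro conv_radius_geI) (auto simp: sums_iff)
    with t0 show ?thesis
      by (metis abs_of_pos ereal_less(2) less_le_trans real_norm_def)
  qed
  define E where "E = fps_const (pi ^ CARD('n)) * complete_sym s"
  have E_exp: "g has_fps_expansion E"
  proof -
    have "(\<lambda>t. pi ^ CARD('n) * (\<Prod>i\<in>UNIV. inverse (1 - s i * t))) has_fps_expansion E"
      unfolding E_def complete_sym_def by (intro fps_expansion_intros) auto
    also have "(\<lambda>t. pi ^ CARD('n) * (\<Prod>i\<in>UNIV. inverse (1 - s i * t))) = g"
      by (simp add: g_def fun_eq_iff prod_dividef prod_inversef field_simps)
    finally show ?thesis .
  qed
  have "F - E = 0"
  proof (rule fps_eq_0_of_eval_at_right)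
    have E_conv: "fps_conv_radius E > 0" and E_ev: "eventually (\<lambda>t. eval_fps E t = g t) (nhds 0)"
      using E_exp by (auto simp: has_fps_expansion_def)
    have "min (fps_conv_radius F) (fps_conv_radius E) > 0"
      using F_conv E_conv by simp
    then show "fps_conv_radius (F - E) > 0"
      using fps_conv_radius_diff less_le_trans by blast
    obtain r where r: "r > 0" "ereal r < min (fps_conv_radius F) (fps_conv_radius E)"
      using \<open>min (fps_conv_radius F) (fps_conv_radius E) > 0\<close>
        ereal_dense2[of 0 "min (fps_conv_radius F) (fps_conv_radius E)"] by (metis ereal_less(2))
    have "eventually (\<lambda>t. t \<in> {0<..<min r t0}) (at_right (0::real))"
      using r t0 by (intro eventually_at_right_real) simp
    moreover have "eventually (\<lambda>t. eval_fps E t = g t) (at_right 0)"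
      using E_ev at_within_le_nhds filter_leD by blast
    ultimately show "eventually (\<lambda>t. eval_fps (F - E) t = 0) (at_right 0)"
    proof eventually_elim
      case (elim t)
      then have "ereal (norm t) < fps_conv_radius F" "ereal (norm t) < fps_conv_radius E"
        using r by (auto intro: less_trans[of _ "ereal r"])
      moreover have "eval_fps F t = g t"
        using F_sums[of t] elim by (simp add: eval_fps_def sums_iff)
      ultimately show ?case
        using elim by (simp add: eval_fps_diff)
    qed
  qed
  then have "fps_nth F k = fps_nth E k"
    by simp
  then have "enn2real (M k) / fact k = pi ^ CARD('n) * fps_nth (complete_sym s) k"
    by (simp add: F_def E_def)
  then have "enn2real (M k) = pi ^ CARD('n) * fact k * fps_nth (complete_sym s) k"
    by (simp add: field_simps)
  then show ?thesis
    using M[of k] by (simp add: M_def H_def)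
qed

text \<open>The projection sends the origin to 0, which is off the sphere. Because
  \<open>h 0 = 0\<close>, the indicator of the sphere can nevertheless be dropped
  everywhere.\<close>

lemma integral_sphere_measure:
  fixes h :: "complex^'n \<Rightarrow> real"
  assumes [measurable]: "h \<in> borel_measurable borel" and h: "\<And>x. h x \<ge> 0" "h 0 = 0"
  shows "(\<integral>\<xi>. h \<xi> \<partial>sphere_measure) =
    enn2real ((\<integral>\<^sup>+x. ennreal (h (x /\<^sub>R norm x)) * indicator (ball 0 1) x \<partial>lborel) /
      emeasure lborel (ball (0 :: complex^'n) 1))"
proof -
  let ?u = "uniform_measure lborel (ball (0 :: complex^'n) 1)"
  have [measurable]: "ball (0 :: complex^'n) 1 \<in> sets borel" "sphere (0 :: complex^'n) 1 \<in> sets borel"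
    by auto
  have "(\<integral>\<xi>. h \<xi> \<partial>sphere_measure) = enn2real (\<integral>\<^sup>+\<xi>. ennreal (h \<xi>) \<partial>sphere_measure)"
    unfolding sphere_measure_def
    by (intro integral_eq_nn_integral measurable_restrict_space1) (auto simp: h)
  also have "(\<integral>\<^sup>+\<xi>. ennreal (h \<xi>) \<partial>sphere_measure) =
      (\<integral>\<^sup>+\<xi>. ennreal (h \<xi>) * indicator (sphere 0 1) \<xi> \<partial>distr ?u borel (\<lambda>x. x /\<^sub>R norm x))"
    unfolding sphere_measure_def by (rule nn_integral_restrict_space) simp
  also have "\<dots> = (\<integral>\<^sup>+x. ennreal (h (x /\<^sub>R norm x)) * indicator (sphere 0 1) (x /\<^sub>R norm x) \<partial>?u)"
    by (rule nn_integral_distr) measurable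
  also have "\<dots> = (\<integral>\<^sup>+x. ennreal (h (x /\<^sub>R norm x)) \<partial>?u)"
  proof (rule nn_integral_cong)
    show "ennreal (h (x /\<^sub>R norm x)) * indicator (sphere 0 1) (x /\<^sub>R norm x) = ennreal (h (x /\<^sub>R norm x))" for x
      by (cases "x = 0") (auto simp: h indicator_def)
  qed
  also have "\<dots> = (\<integral>\<^sup>+x. ennreal (h (x /\<^sub>R norm x)) * indicator (ball 0 1) x \<partial>lborel) / emeasure lborel (ball (0 :: complex^'n) 1)"
    by (rule nn_integral_uniform_measure) auto
  finally show ?thesis .
qed

theorem complete_sym_eq_sphere_integral:
  fixes s :: "'n::finite \<Rightarrow> real" and T :: "complex^'n \<Rightarrow> complex^'n"
  assumes s: "\<And>i. s i \<ge> 0" and k: "k \<ge> 1" and T: "orthogonal_transformation T"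
  shows "real ((CARD('n) + k - 1) choose k) *
      (\<integral>\<xi>. (\<Sum>i\<in>UNIV. s i * (norm (T \<xi> $ i))\<^sup>2) ^ k \<partial>sphere_measure) = fps_nth (complete_sym s) k"
proof -
  define H where "H x = (\<Sum>i\<in>UNIV. s i * (norm (x $ i))\<^sup>2)" for x :: "complex^'n"
  \<comment> \<open>The extension of H^k from the sphere that is constant along rays.\<close>
  define f where "f x = (H x / (norm x)\<^sup>2) ^ k" for x
  define V where "V = emeasure lborel (ball (0 :: complex^'n) 1)"
  define J where "J = (\<integral>\<^sup>+x. ennreal (f x) * indicator (ball 0 1) x \<partial>lborel)"
  have lin: "linear T" and nrm: "norm (T x) = norm x" for x
    using T by (auto simp: orthogonal_transformation)
  have H0: "H x \<ge> 0" for x by (simp add: H_def s sum_nonneg)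
  then have f0: "f x \<ge> 0" for x by (simp add: f_def)
  have H_scale: "H (c *\<^sub>R x) = c\<^sup>2 * H x" for c x
    by (simp add: H_def sum_distrib_left power_mult_distrib mult_ac)
  have H_0: "H 0 = 0"
    by (simp add: H_def)
  have [measurable]: "H \<in> borel_measurable borel"
    unfolding H_def by (intro borel_measurable_continuous_onI continuous_intros)
  have [measurable]: "T \<in> borel_measurable borel"
    using lin by (intro borel_measurable_continuous_onI linear_continuous_on)
      (simp add: linear_conv_bounded_linear)
  have [measurable]: "f \<in> borel_measurable borel"
    unfolding f_def by measurable
  have [measurable]: "ball (0 :: complex^'n) 1 \<in> sets borel" by simp
  have f_T: "H (T (x /\<^sub>R norm x)) ^ k = f (T x)" for x
    using linear_scale[OF lin] by (simp add: H_scale f_def nrm divide_inverse power_inverse mult.commute)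
  have "(\<integral>\<xi>. H (T \<xi>) ^ k \<partial>sphere_measure) = enn2real ((\<integral>\<^sup>+x. ennreal (f (T x)) * indicator (ball 0 1) x \<partial>lborel) / V)"
    unfolding V_def f_T[symmetric] using k linear_0[OF lin]
    by (intro integral_sphere_measure) (auto simp: H0 H_0)
  also have "(\<integral>\<^sup>+x. ennreal (f (T x)) * indicator (ball 0 1) x \<partial>lborel) = J"
  proof -
    have "J = (\<integral>\<^sup>+x. ennreal (f x) * indicator (ball 0 1) x \<partial>distr lborel borel T)"
      by (simp add: J_def distr_lborel_orthogonal_transformation[OF T])
    also have "\<dots> = (\<integral>\<^sup>+x. ennreal (f (T x)) * indicator (ball 0 1) (T x) \<partial>lborel)"
      by (rule nn_integral_distr) measurable
    finally show ?thesis by (simp add: indicator_def nrm)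
  qed
  finally have int: "(\<integral>\<xi>. H (T \<xi>) ^ k \<partial>sphere_measure) = enn2real (J / V)" .
  have V: "V \<noteq> 0" "V < \<infinity>"
    using content_ball_pos[of 1 "0 :: complex^'n"] emeasure_lborel_ball_finite
    by (auto simp: V_def measure_def)
  have f_le: "f x \<le> (\<Sum>i\<in>UNIV. s i) ^ k" for x
  proof -
    have "s i * (norm (x $ i))\<^sup>2 \<le> s i * (norm x)\<^sup>2" for i
      by (intro mult_left_mono power_mono Finite_Cartesian_Product.norm_nth_le s) simp
    then have "H x \<le> (\<Sum>i\<in>UNIV. s i) * (norm x)\<^sup>2"
      unfolding H_def sum_distrib_right by (intro sum_mono)
    then have "H x / (norm x)\<^sup>2 \<le> (\<Sum>i\<in>UNIV. s i)"
      by (cases "x = 0") (simp_all add: divide_simps s sum_nonneg)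
    then show ?thesis
      unfolding f_def by (intro power_mono) (simp_all add: H0)
  qed
  have J: "J < \<infinity>"
  proof -
    have "J \<le> (\<integral>\<^sup>+x. ennreal ((\<Sum>i\<in>UNIV. s i) ^ k) * indicator (ball 0 1) (x :: complex^'n) \<partial>lborel)"
      unfolding J_def by (intro nn_integral_mono mult_right_mono ennreal_leI f_le) simp
    also have "\<dots> = ennreal ((\<Sum>i\<in>UNIV. s i) ^ k) * V"
      by (simp add: V_def nn_integral_cmult)
    also have "\<dots> < \<infinity>"
      using V by (simp add: ennreal_mult_less_top)
    finally show ?thesis .
  qed
  define C where "C = pi ^ CARD('n) * fact k"
  define c where "c = real ((CARD('n) + k - 1) choose k)"
  \<comment> \<open>The factor r^(2k) cancels the denominator of \<open>f\<close>, so that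
    \<open>?g (norm x) * f x\<close> is the Gaussian moment integrand.\<close>
  let ?g = "\<lambda>r::real. ennreal (exp (- r\<^sup>2) * (r\<^sup>2) ^ k)"
  have "V * (\<integral>\<^sup>+x. ?g (norm x) * ennreal (f x) \<partial>lborel) = J * (\<integral>\<^sup>+x. ?g (norm (x :: complex^'n)) \<partial>lborel)"
    unfolding V_def J_def
  proof (rule nn_integral_radial_times_homogeneous)
    show "ennreal (f (a *\<^sub>R x)) = ennreal (f x)" if "a > 0" for a x
      using that by (simp add: f_def H_scale power_mult_distrib)
  qed (use J in \<open>simp_all add: J_def\<close>)
  moreover have "(\<integral>\<^sup>+x. ?g (norm x) * ennreal (f x) \<partial>lborel) = ennreal (C * fps_nth (complete_sym s) k)"
  proof -
    have "?g (norm x) * ennreal (f x) = ennreal (exp (- (norm x)\<^sup>2) * H x ^ k)" for x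
    proof -
      have "((norm x)\<^sup>2) ^ k * f x = H x ^ k"
        using k by (cases "x = 0") (simp_all add: f_def power_divide H_def)
      then show ?thesis by (simp add: f0 mult.assoc flip: ennreal_mult)
    qed
    then show ?thesis
      using gaussian_moment_complete_sym[OF s, where k = k] by (simp add: C_def H_def)
  qed
  \<comment> \<open>The radial constant is itself a moment: for all s_i = 1, H is the squared norm.
    The binomial coefficient of the theorem comes from here.\<close>
  moreover have "(\<integral>\<^sup>+x. ?g (norm (x :: complex^'n)) \<partial>lborel) = ennreal (C * c)"
    using gaussian_moment_complete_sym[where s = "\<lambda>_::'n. 1" and k = k]
    by (simp add: C_def c_def complete_sym_one_nth flip: norm_vec_power2)
  ultimately have eq: "V * ennreal (C * fps_nth (complete_sym s) k) = J * ennreal (C * c)"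
    by simp
  obtain v where v: "V = ennreal v" "v > 0"
    using V by (metis ennreal_cases ennreal_eq_0_iff infinity_ennreal_def less_irrefl not_le)
  obtain j where j: "J = ennreal j" "j \<ge> 0"
    using J by (metis ennreal_cases infinity_ennreal_def less_irrefl)
  \<comment> \<open>Nonnegativity is read off the power-sum expansion; it lets the
    \<open>ennreal\<close> equation descend to the reals.\<close>
  have hk: "fps_nth (complete_sym s) k \<ge> 0"
    unfolding complete_sym_nth_power_sums
    by (intro sum_nonneg prod_nonneg) (auto intro!: divide_nonneg_nonneg zero_le_power sum_nonneg s)
  have C: "C > 0" by (simp add: C_def)
  have "v * (C * fps_nth (complete_sym s) k) = j * (C * c)"
    using eq v j hk C by (simp add: c_def flip: ennreal_mult)
  then have "fps_nth (complete_sym s) k = c * (j / v)"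
    using C v by (simp add: field_simps)
  moreover have "enn2real (J / V) = j / v"
    using v j by (simp add: divide_ennreal)
  ultimately show ?thesis
    using int by (simp add: c_def H_def)
qed

section \<open>Reduction of both sides to singular values\<close>

lemma orthogonal_transformation_unitary:
  fixes U :: "complex^'n^'n"
  assumes "unitary_mat U"
  shows "orthogonal_transformation ((*v) U)"
proof -
  have "(U *v x) \<bullet> (U *v y) = x \<bullet> y" for x y
    using assms unfolding unitary_mat_def
    by (simp add: hinner_conj_transpose matrix_vector_mul_assoc flip: Re_hinner)
  then show ?thesis
    by (simp add: orthogonal_transformation_def linear_matrix_vector_mult)
qed

lemma unitary_mat_conj_transpose: "unitary_mat U \<Longrightarrow> unitary_mat (conj_transpose U)"
  by (simp add: unitary_mat_def)

lemma real_diag_mult_vec_nth: "(real_diag d *v x) $ i = complex_of_real (d i) * x $ i"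
  by (simp add: real_diag_def matrix_vector_mult_def if_distribR if_distrib cong: if_cong)

lemma trace_unitary_conj:
  fixes U :: "complex^'n^'n"
  assumes "unitary_mat U"
  shows "trace (U ** real_diag d ** conj_transpose U) = complex_of_real (\<Sum>i\<in>UNIV. d i)"
proof -
  have "trace (U ** real_diag d ** conj_transpose U) = trace (conj_transpose U ** U ** real_diag d)"
    by (metis matrix_mul_assoc trace_mul_sym)
  also have "\<dots> = trace (real_diag d :: complex^'n^'n)"
    using assms by (simp add: unitary_mat_def)
  finally show ?thesis
    by (simp add: trace_def real_diag_def)
qed

text \<open>In the eigenbasis, \<open>d i\<close> is the squared norm of column \<open>i\<close> of
  \<open>A ** U\<close>.\<close>

lemma gram_eigenvalue_nonneg:
  fixes A U :: "complex^'n^'n"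
  assumes U: "unitary_mat U" and eq: "conj_transpose A ** A = U ** real_diag d ** conj_transpose U"
  shows "d i \<ge> 0"
proof -
  let ?B = "A ** U"
  have "real_diag d = conj_transpose U ** (U ** real_diag d ** conj_transpose U) ** U"
    using U by (simp add: unitary_mat_def matrix_mul_assoc) (simp add: flip: matrix_mul_assoc)
  also have "\<dots> = conj_transpose ?B ** ?B"
    by (simp add: conj_transpose_mult matrix_mul_assoc flip: eq)
  finally have diag: "real_diag d = conj_transpose ?B ** ?B" .
  have "complex_of_real (d i) = (real_diag d :: complex^'n^'n) $ i $ i"
    by (simp add: real_diag_def)
  also have "\<dots> = (conj_transpose ?B ** ?B) $ i $ i"
    by (simp only: diag)
  also have "\<dots> = hinner (\<chi> j. ?B $ j $ i) (\<chi> j. ?B $ j $ i)"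
  proof -
    have "(conj_transpose B ** B) $ i $ i = hinner (\<chi> j. B $ j $ i) (\<chi> j. B $ j $ i)" for B :: "complex^'n^'n"
      by (simp add: matrix_matrix_mult_def conj_transpose_def hinner_def)
    then show ?thesis .
  qed
  finally have "d i = (norm (\<chi> j. ?B $ j $ i))\<^sup>2"
    unfolding hinner_self of_real_eq_iff .
  then show ?thesis by simp
qed

text \<open>One \<open>U\<close> and one family \<open>s\<close> of singular values serve all
  exponents, so the power 1/2 in N_k and the powers in the Schatten norms refer to the same
  numbers.\<close>

lemma mat_abs_diagonalization:
  fixes A :: "complex^'n^'n"
  obtains U s where "unitary_mat U" "\<And>i. s i \<ge> 0"
    "\<And>p. psd_powr (mat_abs A) p = U ** real_diag (\<lambda>i. s i powr p) ** conj_transpose U"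
proof -
  have "conj_transpose (conj_transpose A ** A) = conj_transpose A ** A"
    by (simp add: conj_transpose_mult)
  then obtain U d where U: "unitary_mat U" and eq: "conj_transpose A ** A = U ** real_diag d ** conj_transpose U"
    using hermitian_diagonalization by blast
  have "mat_abs A = U ** real_diag (\<lambda>i. sqrt (d i)) ** conj_transpose U"
    unfolding mat_abs_def eq by (rule herm_fun_diagonalization[OF U])
  then have "psd_powr (mat_abs A) p = U ** real_diag (\<lambda>i. sqrt (d i) powr p) ** conj_transpose U" for p
    unfolding psd_powr_def by (simp add: herm_fun_diagonalization[OF U])
  with U gram_eigenvalue_nonneg[OF U eq] show thesis
    by (intro that[of U "\<lambda>i. sqrt (d i)"]) auto
qed

theorem corollary2p1:
  fixes A :: "complex^'n^'n" and k :: nat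
  assumes "k \<ge> 1"
  shows "real ((CARD('n) + k - 1) choose k) * N_norm (real k) A ^ k =
    (\<Sum>l=1..k. \<Sum>\<beta>\<in>partitions_with_parts k l.
       1 / real (z_part k \<beta>) * (\<Prod>t=1..l. schatten_norm (real (\<beta> t)) A ^ \<beta> t))"
proof -
  obtain U s where U: "unitary_mat U" and s: "\<And>i. s i \<ge> 0"
    and pow: "\<And>p. psd_powr (mat_abs A) p = U ** real_diag (\<lambda>i. s i powr p) ** conj_transpose U"
    using mat_abs_diagonalization[of A] by blast
  have root: "(x powr (1 / real b)) ^ b = x" if "x \<ge> 0" "b \<ge> 1" for x b
    using that by (cases "x = 0") (simp_all add: powr_powr flip: powr_realpow)
  \<comment> \<open>The bound on \<open>b\<close> matters at x = 0, since
    \<open>0 powr 0 = 0\<close> but \<open>0 ^ 0 = 1\<close>.\<close>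
  have pw: "x powr real b = x ^ b" if "x \<ge> 0" "b \<ge> 1" for x b
    using that by (cases "x = 0") (simp_all add: powr_realpow)
  have schatten: "schatten_norm (real b) A ^ b = (\<Sum>i\<in>UNIV. s i ^ b)" if "b \<ge> 1" for b
  proof -
    have "Re (trace (psd_powr (mat_abs A) (real b))) = (\<Sum>i\<in>UNIV. s i ^ b)"
      using that by (simp add: pow trace_unitary_conj[OF U] pw s)
    then show ?thesis
      unfolding schatten_norm_def using that s by (simp add: root sum_nonneg)
  qed
  let ?T = "(*v) (conj_transpose U)"
  have nrm: "norm (psd_powr (mat_abs A) (1/2) *v \<xi>) powr (2 * real k) =
      (\<Sum>i\<in>UNIV. s i * (norm (?T \<xi> $ i))\<^sup>2) ^ k" for \<xi>
  proof -
    \<comment> \<open>The outer \<open>U\<close> preserves the norm, leaving a diagonal matrix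
      applied to \<open>?T \<xi>\<close>; \<open>?T\<close> is the isometry absorbed by the sphere
      integral.\<close>
    have "psd_powr (mat_abs A) (1/2) *v \<xi> = U *v (real_diag (\<lambda>i. s i powr (1/2)) *v ?T \<xi>)"
      by (simp add: pow matrix_vector_mul_assoc matrix_mul_assoc)
    then have "norm (psd_powr (mat_abs A) (1/2) *v \<xi>) = norm (real_diag (\<lambda>i. s i powr (1/2)) *v ?T \<xi>)"
      using orthogonal_transformation_unitary[OF U] by (simp add: orthogonal_transformation)
    then have "(norm (psd_powr (mat_abs A) (1/2) *v \<xi>))\<^sup>2 = (\<Sum>i\<in>UNIV. s i * (norm (?T \<xi> $ i))\<^sup>2)"
      using s by (simp add: norm_vec_power2 real_diag_mult_vec_nth norm_mult power_mult_distrib powr_half_sqrt)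
    moreover have "norm (psd_powr (mat_abs A) (1/2) *v \<xi>) powr real (2 * k) =
        (norm (psd_powr (mat_abs A) (1/2) *v \<xi>))\<^sup>2 ^ k"
      using assms by (simp only: power_mult[symmetric]) (intro pw; simp)
    ultimately show ?thesis by simp
  qed
  have "N_norm (real k) A ^ k = (\<integral>\<xi>. (\<Sum>i\<in>UNIV. s i * (norm (?T \<xi> $ i))\<^sup>2) ^ k \<partial>sphere_measure)"
    unfolding N_norm_def nrm using assms s by (intro root Bochner_Integration.integral_nonneg zero_le_power sum_nonneg mult_nonneg_nonneg) auto
  then have "real ((CARD('n) + k - 1) choose k) * N_norm (real k) A ^ k = fps_nth (complete_sym s) k"
    using complete_sym_eq_sphere_integral[OF s assms orthogonal_transformation_unitary[OF unitary_mat_conj_transpose[OF U]]]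
    by simp
  also have "\<dots> = (\<Sum>l=1..k. \<Sum>\<beta>\<in>partitions_with_parts k l.
      1 / real (z_part k \<beta>) * (\<Prod>t=1..l. \<Sum>i\<in>UNIV. s i ^ \<beta> t))"
    unfolding complete_sym_nth_power_sums by (rule sum_partitions_with_parts[OF assms, symmetric])
  also have "\<dots> = (\<Sum>l=1..k. \<Sum>\<beta>\<in>partitions_with_parts k l.
      1 / real (z_part k \<beta>) * (\<Prod>t=1..l. schatten_norm (real (\<beta> t)) A ^ \<beta> t))"
  proof (intro sum.cong refl arg_cong2[where f = "(*)"] prod.cong)
    fix l \<beta> t assume "l \<in> {1..k}" "\<beta> \<in> partitions_with_parts k l" "t \<in> {1..l}"
    \<comment> \<open>Exponent 0 would break the identity: the sum would be CARD('n), while the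
      power of the Schatten norm would be 1.\<close>
    then have "\<beta> t \<noteq> 0"
      using partitions_with_parts_support by blast
    then show "(\<Sum>i\<in>UNIV. s i ^ \<beta> t) = schatten_norm (real (\<beta> t)) A ^ \<beta> t"
      by (simp add: schatten)
  qed
  finally show ?thesis .
qed

end
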